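(* Let $\mathcal A$ be an abelian category of finite length and let $X\in\mathcal A$ have nonisomorphic simple factors $\{S^i:i\in I\}$, $|I|=n$, with associated partial order $\preceq$ on $I$ (as defined in the context). Let $\phi:I\to\{1,\ldots,n\}$ be a bijection. Then there exists a unique composition series $0=B_0\subset\cdots\subset B_n=X$ with $S^i\cong B_{\phi(i)}/B_{\phi(i)-1}$ for all $i\in I$ if and only if $i\preceq j$ implies $\phi(i)\le\phi(j)$ (for all $i,j\in I$).
   Context: An abelian category is of finite length if it is artinian and noetherian (all descending and all ascending chains of subobjects of any object stabilize). A composition series for $X$ is a filtration by subobjects $0=A_0\subset A_1\subset\cdots\subset A_n=X$ whose factors $S_k=A_k/A_{k-1}$ are all simple; by the Jordan--H\"older theorem the $S_k$ are independent of choices up to isomorphism and permutation. $X$ has nonisomorphic simple factors if $S_k\not\cong S_l$ for $1\le k<l\le n$. In that case let $I$ be an indexing set with $|I|=n$ and write $\{S_1,\ldots,S_n\}=\{S^i:i\in I\}$. For every composition series $0=B_0\subset B_1\subset\cdots\subset B_n=X$ with $T_k=B_k/B_{k-1}$ there is a unique bijection $\phi:I\to\{1,\ldots,n\}$ with $S^i\cong T_{\phi(i)}$ for all $i\in I$. The partial order $\preceq$ on $I$ is defined by: $i\preceq j$ if and only if $\phi(i)\le\phi(j)$ for all bijections $\phi$ arising in this way from composition series of $X$. *)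

theory Defs
  imports "HOL-Algebra.Group"
begin

section \<open>Categories\<close>

record ('o, 'm) cat =
  Obj :: "'o set"
  Arr :: "'m set"
  Dom :: "'m \<Rightarrow> 'o"
  Cod :: "'m \<Rightarrow> 'o"
  Ident :: "'o \<Rightarrow> 'm"
  Comp :: "'m \<Rightarrow> 'm \<Rightarrow> 'm" (infixl "\<odot>\<index>" 70)

definition Hom :: "('o, 'm, 'z) cat_scheme \<Rightarrow> 'o \<Rightarrow> 'o \<Rightarrow> 'm set" where
  "Hom C a b = {f \<in> Arr C. Dom C f = a \<and> Cod C f = b}"

locale category =
  fixes C (structure)
  assumes dom_obj: "f \<in> Arr C \<Longrightarrow> Dom C f \<in> Obj C"
    and cod_obj: "f \<in> Arr C \<Longrightarrow> Cod C f \<in> Obj C"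
    and ident_hom: "a \<in> Obj C \<Longrightarrow> Ident C a \<in> Hom C a a"
    and comp_hom: "f \<in> Hom C a b \<Longrightarrow> g \<in> Hom C b c \<Longrightarrow> g \<odot> f \<in> Hom C a c"
    and comp_ident: "f \<in> Hom C a b \<Longrightarrow> f \<odot> Ident C a = f"
    and ident_comp: "f \<in> Hom C a b \<Longrightarrow> Ident C b \<odot> f = f"
    and comp_assoc: "f \<in> Hom C a b \<Longrightarrow> g \<in> Hom C b c \<Longrightarrow> h \<in> Hom C c d
      \<Longrightarrow> (h \<odot> g) \<odot> f = h \<odot> (g \<odot> f)"

definition monic :: "('o, 'm, 'z) cat_scheme \<Rightarrow> 'm \<Rightarrow> bool" where
  "monic C f \<longleftrightarrow> f \<in> Arr C \<and>
     (\<forall>a. \<forall>g \<in> Hom C a (Dom C f). \<forall>h \<in> Hom C a (Dom C f).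
        f \<odot>\<^bsub>C\<^esub> g = f \<odot>\<^bsub>C\<^esub> h \<longrightarrow> g = h)"

definition epic :: "('o, 'm, 'z) cat_scheme \<Rightarrow> 'm \<Rightarrow> bool" where
  "epic C f \<longleftrightarrow> f \<in> Arr C \<and>
     (\<forall>b. \<forall>g \<in> Hom C (Cod C f) b. \<forall>h \<in> Hom C (Cod C f) b.
        g \<odot>\<^bsub>C\<^esub> f = h \<odot>\<^bsub>C\<^esub> f \<longrightarrow> g = h)"

definition isomorphic :: "('o, 'm, 'z) cat_scheme \<Rightarrow> 'o \<Rightarrow> 'o \<Rightarrow> bool" where
  "isomorphic C a b \<longleftrightarrow> a \<in> Obj C \<and> b \<in> Obj C \<and>
     (\<exists>f \<in> Hom C a b. \<exists>g \<in> Hom C b a.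
        g \<odot>\<^bsub>C\<^esub> f = Ident C a \<and> f \<odot>\<^bsub>C\<^esub> g = Ident C b)"

definition zero_object :: "('o, 'm, 'z) cat_scheme \<Rightarrow> 'o \<Rightarrow> bool" where
  "zero_object C z \<longleftrightarrow> z \<in> Obj C \<and>
     (\<forall>a \<in> Obj C. (\<exists>!f. f \<in> Hom C a z) \<and> (\<exists>!f. f \<in> Hom C z a))"


section \<open>Abelian categories\<close>

record ('o, 'm) preadd_cat = "('o, 'm) cat" +
  Plus :: "'m \<Rightarrow> 'm \<Rightarrow> 'm" (infixl "\<uplus>\<index>" 65)
  Zero :: "'o \<Rightarrow> 'o \<Rightarrow> 'm"

definition Hom_group :: "('o, 'm, 'z) preadd_cat_scheme \<Rightarrow> 'o \<Rightarrow> 'o \<Rightarrow> 'm monoid" where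
  "Hom_group C a b = \<lparr>carrier = Hom C a b, mult = Plus C, one = Zero C a b\<rparr>"

locale preadditive_category = category C for C (structure) +
  assumes hom_comm_group: "a \<in> Obj C \<Longrightarrow> b \<in> Obj C \<Longrightarrow> comm_group (Hom_group C a b)"
    and comp_plus: "f \<in> Hom C a b \<Longrightarrow> g \<in> Hom C b c \<Longrightarrow> g' \<in> Hom C b c
      \<Longrightarrow> (g \<uplus> g') \<odot> f = (g \<odot> f) \<uplus> (g' \<odot> f)"
    and plus_comp: "f \<in> Hom C a b \<Longrightarrow> f' \<in> Hom C a b \<Longrightarrow> g \<in> Hom C b c
      \<Longrightarrow> g \<odot> (f \<uplus> f') = (g \<odot> f) \<uplus> (g \<odot> f')"

definition is_kernel :: "('o, 'm, 'z) preadd_cat_scheme \<Rightarrow> 'm \<Rightarrow> 'm \<Rightarrow> bool" where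
  "is_kernel C f k \<longleftrightarrow> f \<in> Arr C \<and> k \<in> Arr C \<and> Cod C k = Dom C f \<and>
     f \<odot>\<^bsub>C\<^esub> k = Zero C (Dom C k) (Cod C f) \<and>
     (\<forall>a. \<forall>g \<in> Hom C a (Dom C f). f \<odot>\<^bsub>C\<^esub> g = Zero C a (Cod C f) \<longrightarrow>
        (\<exists>!u. u \<in> Hom C a (Dom C k) \<and> k \<odot>\<^bsub>C\<^esub> u = g))"

definition is_cokernel :: "('o, 'm, 'z) preadd_cat_scheme \<Rightarrow> 'm \<Rightarrow> 'm \<Rightarrow> bool" where
  "is_cokernel C f q \<longleftrightarrow> f \<in> Arr C \<and> q \<in> Arr C \<and> Dom C q = Cod C f \<and>
     q \<odot>\<^bsub>C\<^esub> f = Zero C (Dom C f) (Cod C q) \<and>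
     (\<forall>b. \<forall>g \<in> Hom C (Cod C f) b. g \<odot>\<^bsub>C\<^esub> f = Zero C (Dom C f) b \<longrightarrow>
        (\<exists>!u. u \<in> Hom C (Cod C q) b \<and> u \<odot>\<^bsub>C\<^esub> q = g))"

locale abelian_category = preadditive_category C for C (structure) +
  assumes ex_zero_object: "\<exists>z. zero_object C z"
    and ex_biproduct: "a \<in> Obj C \<Longrightarrow> b \<in> Obj C \<Longrightarrow>
      \<exists>s. \<exists>i \<in> Hom C a s. \<exists>j \<in> Hom C b s. \<exists>p \<in> Hom C s a. \<exists>q \<in> Hom C s b.
        p \<odot> i = Ident C a \<and> q \<odot> j = Ident C b \<and> (i \<odot> p) \<uplus> (j \<odot> q) = Ident C s"
    and ex_kernel: "f \<in> Arr C \<Longrightarrow> \<exists>k. is_kernel C f k"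
    and ex_cokernel: "f \<in> Arr C \<Longrightarrow> \<exists>q. is_cokernel C f q"
    and monic_is_kernel: "monic C k \<Longrightarrow> \<exists>f. is_kernel C f k"
    and epic_is_cokernel: "epic C q \<Longrightarrow> \<exists>f. is_cokernel C f q"


section \<open>Subobjects, finite length\<close>

definition monos_into :: "('o, 'm, 'z) cat_scheme \<Rightarrow> 'o \<Rightarrow> 'm set" where
  "monos_into C X = {i. monic C i \<and> Cod C i = X}"

definition factors_through :: "('o, 'm, 'z) cat_scheme \<Rightarrow> 'm \<Rightarrow> 'm \<Rightarrow> bool" where
  "factors_through C i j \<longleftrightarrow> (\<exists>h \<in> Hom C (Dom C i) (Dom C j). i = j \<odot>\<^bsub>C\<^esub> h)"

definition sub_rel :: "('o, 'm, 'z) cat_scheme \<Rightarrow> 'o \<Rightarrow> ('m \<times> 'm) set" where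
  "sub_rel C X = {(i, j). i \<in> monos_into C X \<and> j \<in> monos_into C X \<and>
     factors_through C i j \<and> factors_through C j i}"

text \<open>A subobject of \<open>X\<close> is an equivalence class of monomorphisms into \<open>X\<close>, so that
  equality of subobjects is equality of sets of arrows.\<close>

definition Sub :: "('o, 'm, 'z) cat_scheme \<Rightarrow> 'o \<Rightarrow> 'm set set" where
  "Sub C X = monos_into C X // sub_rel C X"

definition sub_le :: "('o, 'm, 'z) cat_scheme \<Rightarrow> 'm set \<Rightarrow> 'm set \<Rightarrow> bool" where
  "sub_le C P Q \<longleftrightarrow> (\<exists>i \<in> P. \<exists>j \<in> Q. factors_through C i j)"

definition zero_sub :: "('o, 'm, 'z) cat_scheme \<Rightarrow> 'o \<Rightarrow> 'm set" where
  "zero_sub C X = {i \<in> monos_into C X. zero_object C (Dom C i)}"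

definition full_sub :: "('o, 'm, 'z) cat_scheme \<Rightarrow> 'o \<Rightarrow> 'm set" where
  "full_sub C X = sub_rel C X `` {Ident C X}"

definition noetherian_object :: "('o, 'm, 'z) cat_scheme \<Rightarrow> 'o \<Rightarrow> bool" where
  "noetherian_object C X \<longleftrightarrow> (\<forall>P :: nat \<Rightarrow> 'm set.
     (\<forall>n. P n \<in> Sub C X) \<and> (\<forall>n. sub_le C (P n) (P (Suc n))) \<longrightarrow> (\<exists>N. \<forall>m\<ge>N. P m = P N))"

definition artinian_object :: "('o, 'm, 'z) cat_scheme \<Rightarrow> 'o \<Rightarrow> bool" where
  "artinian_object C X \<longleftrightarrow> (\<forall>P :: nat \<Rightarrow> 'm set.
     (\<forall>n. P n \<in> Sub C X) \<and> (\<forall>n. sub_le C (P (Suc n)) (P n)) \<longrightarrow> (\<exists>N. \<forall>m\<ge>N. P m = P N))"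

locale finite_length_category = abelian_category C for C (structure) +
  assumes noetherian: "X \<in> Obj C \<Longrightarrow> noetherian_object C X"
    and artinian: "X \<in> Obj C \<Longrightarrow> artinian_object C X"

definition simple_object :: "('o, 'm, 'z) cat_scheme \<Rightarrow> 'o \<Rightarrow> bool" where
  "simple_object C S \<longleftrightarrow> S \<in> Obj C \<and> \<not> zero_object C S \<and>
     Sub C S = {zero_sub C S, full_sub C S}"


section \<open>Composition series\<close>

text \<open>For subobjects \<open>P \<le> Q\<close> of the same object, \<open>quotient_object C Q P\<close> is the target of a
  cokernel of an inclusion of a representative of \<open>P\<close> into a representative of \<open>Q\<close>.
  It is determined up to isomorphism only, and is used only up to isomorphism.\<close>

definition is_quotient :: "('o, 'm, 'z) preadd_cat_scheme \<Rightarrow> 'm set \<Rightarrow> 'm set \<Rightarrow> 'o \<Rightarrow> bool" where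
  "is_quotient C Q P Z \<longleftrightarrow>
     (\<exists>i \<in> P. \<exists>j \<in> Q. \<exists>h \<in> Hom C (Dom C i) (Dom C j). i = j \<odot>\<^bsub>C\<^esub> h \<and>
        (\<exists>q. is_cokernel C h q \<and> Cod C q = Z))"

definition quotient_object :: "('o, 'm, 'z) preadd_cat_scheme \<Rightarrow> 'm set \<Rightarrow> 'm set \<Rightarrow> 'o" where
  "quotient_object C Q P = (SOME Z. is_quotient C Q P Z)"

text \<open>A filtration \<open>0 = B\<^sub>0 \<subset> \<dots> \<subset> B\<^sub>n = X\<close> is the list of its \<open>n + 1\<close> subobjects; its factors
  \<open>B\<^sub>k / B\<^sub>k\<^sub>-\<^sub>1\<close> are numbered by \<open>1 \<le> k \<le> n\<close>.\<close>

definition factor :: "('o, 'm, 'z) preadd_cat_scheme \<Rightarrow> 'm set list \<Rightarrow> nat \<Rightarrow> 'o" where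
  "factor C B k = quotient_object C (B ! k) (B ! (k - 1))"

definition composition_series ::
  "('o, 'm, 'z) preadd_cat_scheme \<Rightarrow> 'o \<Rightarrow> nat \<Rightarrow> 'm set list \<Rightarrow> bool" where
  "composition_series C X n B \<longleftrightarrow>
     length B = n + 1 \<and> set B \<subseteq> Sub C X \<and> B ! 0 = zero_sub C X \<and> B ! n = full_sub C X \<and>
     (\<forall>k \<in> {1..n}. sub_le C (B ! (k - 1)) (B ! k) \<and> B ! (k - 1) \<noteq> B ! k \<and>
        simple_object C (factor C B k))"

definition nonisomorphic_factors ::
  "('o, 'm, 'z) preadd_cat_scheme \<Rightarrow> nat \<Rightarrow> 'm set list \<Rightarrow> bool" where
  "nonisomorphic_factors C n B \<longleftrightarrow>
     (\<forall>k l. 1 \<le> k \<and> k < l \<and> l \<le> n \<longrightarrow> \<not> isomorphic C (factor C B k) (factor C B l))"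

definition factors_labelled ::
  "('o, 'm, 'z) preadd_cat_scheme \<Rightarrow> 'i set \<Rightarrow> ('i \<Rightarrow> 'o) \<Rightarrow> 'm set list \<Rightarrow> ('i \<Rightarrow> nat) \<Rightarrow> bool" where
  "factors_labelled C I S B \<phi> \<longleftrightarrow> (\<forall>i \<in> I. isomorphic C (S i) (factor C B (\<phi> i)))"

definition factor_le ::
  "('o, 'm, 'z) preadd_cat_scheme \<Rightarrow> 'o \<Rightarrow> 'i set \<Rightarrow> ('i \<Rightarrow> 'o) \<Rightarrow> 'i \<Rightarrow> 'i \<Rightarrow> bool" where
  "factor_le C X I S i j \<longleftrightarrow>
     (\<forall>n B \<phi>. composition_series C X n B \<and> bij_betw \<phi> I {1..n} \<and> factors_labelled C I S B \<phi>
        \<longrightarrow> \<phi> i \<le> \<phi> j)"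

end

theory Submission
  imports Defs
begin

text \<open>
The proof takes place in the lattice of subobjects of \<open>X\<close>, which is modular. For a subobject \<open>Y\<close>
let \<open>labels Y\<close> be the set of those \<open>i\<close> for which the factor \<open>S\<^sup>i\<close> of the given series \<open>A\<close> survives in
\<open>Y\<close>, that is, \<open>Y \<inter> A\<^sub>k\<^sub>-\<^sub>1 \<noteq> Y \<inter> A\<^sub>k\<close> for \<open>k = \<psi> i\<close>. A Jordan--Hoelder argument (\<open>labels_covers\<close>) shows that
replacing \<open>P\<close> by a \<open>Q\<close> with \<open>Q/P\<close> simple adds exactly one label, the one of \<open>Q/P\<close>. The factors being
pairwise nonisomorphic, no label can be added twice on the way up, and this rigidity gives
\<open>labels (Y \<inter> Z) = labels Y \<inter> labels Z\<close> (\<open>labels_meet\<close>). Hence \<open>labels\<close> embeds the lattice of subobjects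
into the subsets of \<open>I\<close> (\<open>le_iff_labels\<close>).

In a composition series labelled by \<open>\<phi>\<close> the \<open>k\<close>-th term has label set \<open>{i. \<phi> i \<le> k}\<close>, so it is
determined by \<open>\<phi>\<close>; this is uniqueness. For existence, each \<open>j\<close> has a least subobject \<open>M\<^sub>j\<close> with
\<open>j \<in> labels M\<^sub>j\<close>, because label sets are compatible with intersections. Every composition series has
reached \<open>M\<^sub>j\<close> at the step where \<open>j\<close> appears, so all labels of \<open>M\<^sub>j\<close> precede \<open>j\<close> in the partial order.
If \<open>\<phi>\<close> is monotone, then all labels of \<open>M\<^sub>j\<close> other than \<open>j\<close> already occur in the term with label set
\<open>{i. \<phi> i < \<phi> j}\<close>, and the sum of that term with \<open>M\<^sub>j\<close> is the next term of the desired series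
(\<open>ex_labels_initial\<close>). The converse direction of the theorem is the definition of the partial order.

Three facts about abelian categories feed this argument: subobjects form a modular lattice, a
quotient \<open>Q/P\<close> is simple exactly if \<open>Q\<close> covers \<open>P\<close>, and \<open>P/(P \<inter> Q) \<cong> (P + Q)/Q\<close>. All three rest on
the correspondence theorem: along an epimorphism \<open>g : a \<rightarrow> b\<close>, taking preimages is an order
isomorphism from the subobjects of \<open>b\<close> onto the subobjects of \<open>a\<close> above the kernel of \<open>g\<close>
(\<open>preimage_le_iff\<close>, \<open>obtain_image_of_preimage\<close>). Every subobject is the kernel of its cokernel, so
this says that the epimorphisms out of \<open>b\<close> are the epimorphisms out of \<open>a\<close> that kill the kernel of
\<open>g\<close>. For \<open>P, Q \<le> X\<close> the image \<open>N\<close> of \<open>P \<rightarrow> X/Q\<close> then controls everything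
(\<open>diamond\<close>): \<open>P + Q\<close> is its preimage in \<open>X\<close>, both quotients above are isomorphic to \<open>N\<close>, and a
subobject between \<open>Q\<close> and \<open>P + Q\<close> is recovered from its intersection with \<open>P\<close>.
\<close>

section \<open>Covers in modular lattices\<close>

locale modular_bounded_lattice = bounded_lattice +
  assumes modular: "\<lbrakk>x \<in> carrier L; y \<in> carrier L; z \<in> carrier L; x \<sqsubseteq> z\<rbrakk>
      \<Longrightarrow> (x \<squnion> y) \<sqinter> z \<sqsubseteq> x \<squnion> (y \<sqinter> z)"
begin

definition covers :: "'a \<Rightarrow> 'a \<Rightarrow> bool" where
  "covers x y \<longleftrightarrow> x \<sqsubseteq> y \<and> x \<noteq> y \<and> (\<forall>z\<in>carrier L. x \<sqsubseteq> z \<and> z \<sqsubseteq> y \<longrightarrow> z = x \<or> z = y)"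

lemma coversI:
  assumes "x \<sqsubseteq> y" "x \<noteq> y" "\<And>z. \<lbrakk>z \<in> carrier L; x \<sqsubseteq> z; z \<sqsubseteq> y; z \<noteq> x\<rbrakk> \<Longrightarrow> z = y"
  shows "covers x y"
  using assms unfolding covers_def by blast

lemma covers_cases:
  assumes "covers x y" "z \<in> carrier L" "x \<sqsubseteq> z" "z \<sqsubseteq> y"
  obtains "z = x" | "z = y"
  using assms unfolding covers_def by blast

lemma le_meet_iff:
  "\<lbrakk>x \<in> carrier L; y \<in> carrier L; z \<in> carrier L\<rbrakk> \<Longrightarrow> z \<sqsubseteq> x \<sqinter> y \<longleftrightarrow> z \<sqsubseteq> x \<and> z \<sqsubseteq> y"
  by (metis le_trans meet_closed meet_le meet_left meet_right)

lemma join_le_iff: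
  "\<lbrakk>x \<in> carrier L; y \<in> carrier L; z \<in> carrier L\<rbrakk> \<Longrightarrow> x \<squnion> y \<sqsubseteq> z \<longleftrightarrow> x \<sqsubseteq> z \<and> y \<sqsubseteq> z"
  by (metis le_trans join_closed join_le join_left join_right)

lemma meet_le1: "\<lbrakk>x \<sqsubseteq> z; x \<in> carrier L; y \<in> carrier L; z \<in> carrier L\<rbrakk> \<Longrightarrow> x \<sqinter> y \<sqsubseteq> z"
  by (rule le_trans[OF meet_left]) simp_all

lemma meet_le2: "\<lbrakk>y \<sqsubseteq> z; x \<in> carrier L; y \<in> carrier L; z \<in> carrier L\<rbrakk> \<Longrightarrow> x \<sqinter> y \<sqsubseteq> z"
  by (rule le_trans[OF meet_right]) simp_all

lemma le_join1: "\<lbrakk>z \<sqsubseteq> x; x \<in> carrier L; y \<in> carrier L; z \<in> carrier L\<rbrakk> \<Longrightarrow> z \<sqsubseteq> x \<squnion> y"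
  by (rule le_trans[OF _ join_left]) simp_all

lemma meet_top_eq: "x \<in> carrier L \<Longrightarrow> x \<sqinter> \<top> = x"
  by (rule le_antisym) (simp_all add: le_meet_iff meet_left)

text \<open>
Intersecting with \<open>x\<close> and joining with \<open>y\<close> are mutually inverse between the intervals \<open>[y, x \<squnion> y]\<close> and
\<open>[x \<sqinter> y, x]\<close> of a modular lattice, so one of them has an intermediate element exactly if the other has.
\<close>

lemma covers_transpose:
  assumes x: "x \<in> carrier L" and y: "y \<in> carrier L"
  shows "covers (x \<sqinter> y) x \<longleftrightarrow> covers y (x \<squnion> y)"
proof
  assume c: "covers (x \<sqinter> y) x"
  show "covers y (x \<squnion> y)"
  proof (rule coversI)
    show "y \<sqsubseteq> x \<squnion> y" using x y by (rule join_right)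
    show "y \<noteq> x \<squnion> y"
    proof
      assume "y = x \<squnion> y"
      then have "x \<sqsubseteq> y" using join_left[OF x y] by simp
      then have "x \<sqinter> y = x" using x y by (intro le_antisym) (simp_all add: le_meet_iff meet_left)
      then show False using c unfolding covers_def by simp
    qed
    fix z assume z: "z \<in> carrier L" "y \<sqsubseteq> z" "z \<sqsubseteq> x \<squnion> y" "z \<noteq> y"
    have m: "x \<sqinter> y \<sqsubseteq> x \<sqinter> z" "x \<sqinter> z \<sqsubseteq> x" "x \<sqinter> z \<in> carrier L"
      using x y z by (simp_all add: le_meet_iff meet_left meet_le2)
    from c m(3,1,2) show "z = x \<squnion> y"
    proof (rule covers_cases)
      assume e: "x \<sqinter> z = x \<sqinter> y"
      have "z \<sqsubseteq> (y \<squnion> x) \<sqinter> z" using x y z by (simp add: le_meet_iff join_comm)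
      also have "\<dots> \<sqsubseteq> y \<squnion> (x \<sqinter> z)" using x y z by (simp add: modular)
      also have "\<dots> \<sqsubseteq> y" using x y e by (simp add: join_le_iff meet_right)
      finally have "z \<sqsubseteq> y" using x y z by simp
      then show ?thesis using le_antisym y z by blast
    next
      assume "x \<sqinter> z = x"
      then have "x \<sqsubseteq> z" using meet_right[OF x z(1)] by simp
      then have "x \<squnion> y \<sqsubseteq> z" using x y z by (simp add: join_le_iff)
      then show ?thesis using le_antisym x y z by simp
    qed
  qed
next
  assume c: "covers y (x \<squnion> y)"
  show "covers (x \<sqinter> y) x"
  proof (rule coversI)
    show "x \<sqinter> y \<sqsubseteq> x" using x y by (rule meet_left)
    show "x \<sqinter> y \<noteq> x"
    proof
      assume "x \<sqinter> y = x"
      then have "x \<sqsubseteq> y" using meet_right[OF x y] by simp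
      then have "x \<squnion> y = y" using x y by (intro le_antisym) (simp_all add: join_le_iff join_right)
      then show False using c unfolding covers_def by simp
    qed
    fix z assume z: "z \<in> carrier L" "x \<sqinter> y \<sqsubseteq> z" "z \<sqsubseteq> x" "z \<noteq> x \<sqinter> y"
    have m: "y \<sqsubseteq> z \<squnion> y" "z \<squnion> y \<sqsubseteq> x \<squnion> y" "z \<squnion> y \<in> carrier L"
      using x y z by (simp_all add: join_le_iff join_right le_join1)
    from c m(3,1,2) show "z = x"
    proof (rule covers_cases)
      assume "z \<squnion> y = y"
      then have "z \<sqsubseteq> y" using join_left[OF z(1) y] by simp
      then have "z \<sqsubseteq> x \<sqinter> y" using x y z by (simp add: le_meet_iff)
      then show ?thesis using le_antisym x y z by simp
    next
      assume e: "z \<squnion> y = x \<squnion> y"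
      have "x \<sqsubseteq> (z \<squnion> y) \<sqinter> x" using x y e by (simp add: le_meet_iff join_left)
      also have "\<dots> \<sqsubseteq> z \<squnion> (y \<sqinter> x)" using x y z by (simp add: modular)
      also have "\<dots> \<sqsubseteq> z" using x y z by (simp add: join_le_iff meet_comm)
      finally have "x \<sqsubseteq> z" using x y z by simp
      then show ?thesis using le_antisym x z by blast
    qed
  qed
qed

end

section \<open>Lattices with labelled covers\<close>

text \<open>
What the Jordan--Hoelder argument needs to know about simple factors: \<open>step i x y\<close> stands for the
quotient \<open>y/x\<close> being a simple object of isomorphism type \<open>i\<close>. Working with this relation instead of the
quotients themselves hides that a quotient is determined only up to isomorphism.
\<close>

locale factor_lattice = modular_bounded_lattice +
  fixes I :: "'i set" and step :: "'i \<Rightarrow> 'a \<Rightarrow> 'a \<Rightarrow> bool" and n :: nat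
  assumes step_covers: "\<lbrakk>i \<in> I; x \<in> carrier L; y \<in> carrier L; step i x y\<rbrakk> \<Longrightarrow> covers x y"
    and step_transpose: "\<lbrakk>i \<in> I; x \<in> carrier L; y \<in> carrier L; covers (x \<sqinter> y) x\<rbrakk>
      \<Longrightarrow> step i (x \<sqinter> y) x \<longleftrightarrow> step i y (x \<squnion> y)"
    and step_unique: "\<lbrakk>i \<in> I; j \<in> I; step i x y; step j x y\<rbrakk> \<Longrightarrow> i = j"
begin

definition series :: "(nat \<Rightarrow> 'a) \<Rightarrow> ('i \<Rightarrow> nat) \<Rightarrow> bool" where
  "series B \<phi> \<longleftrightarrow> bij_betw \<phi> I {1..n} \<and> (\<forall>k\<le>n. B k \<in> carrier L) \<and> B 0 = \<bottom> \<and> B n = \<top> \<and>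
     (\<forall>i\<in>I. step i (B (\<phi> i - 1)) (B (\<phi> i)))"

lemma series_label:
  assumes "series B \<phi>" "k < n"
  obtains i where "i \<in> I" "\<phi> i = Suc k" "step i (B k) (B (Suc k))"
proof -
  have "Suc k \<in> \<phi> ` I" using assms unfolding series_def bij_betw_def by auto
  then obtain i where "i \<in> I" "\<phi> i = Suc k" by auto
  then show thesis using that assms unfolding series_def by force
qed

end

lemma (in factor_lattice) series_cong:
  assumes eq: "\<And>k. k \<le> n \<Longrightarrow> B k = B' k"
  shows "series B \<phi> \<longleftrightarrow> series B' \<phi>"
proof -
  have "B (\<phi> i - 1) = B' (\<phi> i - 1) \<and> B (\<phi> i) = B' (\<phi> i)"
    if "bij_betw \<phi> I {1..n}" "i \<in> I" for i
  proof -
    have "\<phi> i \<le> n" using bij_betwE[OF that(1)] that(2) by auto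
    then show ?thesis by (simp add: eq)
  qed
  then show ?thesis unfolding series_def by (auto simp: eq)
qed

section \<open>Label sets\<close>

text \<open>
A reference series \<open>A\<close> against which all other elements are measured. Since \<open>\<psi>\<close> is injective, the
labels of its steps are distinct.
\<close>

locale factor_series = factor_lattice L I step n
  for L (structure) and I :: "'i set" and step and n +
  fixes A :: "nat \<Rightarrow> 'a" and \<psi> :: "'i \<Rightarrow> nat"
  assumes A_series: "series A \<psi>"
begin

lemma A_closed [simp]: "k \<le> n \<Longrightarrow> A k \<in> carrier L"
  using A_series unfolding series_def by blast

lemma \<psi>_range: "i \<in> I \<Longrightarrow> 1 \<le> \<psi> i \<and> \<psi> i \<le> n"
  using A_series unfolding series_def bij_betw_def by auto

lemma \<psi>_le [simp]: "i \<in> I \<Longrightarrow> \<psi> i \<le> n"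
  using \<psi>_range by blast

lemma A_index [simp]:
  assumes "i \<in> I" shows "A (\<psi> i) \<in> carrier L" "A (\<psi> i - 1) \<in> carrier L" "A (\<psi> i - Suc 0) \<in> carrier L"
proof -
  have "\<psi> i - 1 \<le> n" using \<psi>_le[OF assms] by linarith
  then show "A (\<psi> i) \<in> carrier L" "A (\<psi> i - 1) \<in> carrier L" "A (\<psi> i - Suc 0) \<in> carrier L"
    using assms by simp_all
qed

lemma finite_I: "finite I"
  using A_series bij_betw_finite unfolding series_def by blast

lemma A_step: "i \<in> I \<Longrightarrow> step i (A (\<psi> i - 1)) (A (\<psi> i))"
  using A_series unfolding series_def by blast

lemma A_covers: "i \<in> I \<Longrightarrow> covers (A (\<psi> i - 1)) (A (\<psi> i))"
  using A_step A_index step_covers by blast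

lemma A_mono:
  assumes "k \<le> l" "l \<le> n" shows "A k \<sqsubseteq> A l"
  using assms
proof (induction rule: dec_induct)
  case base then show ?case by simp
next
  case (step m)
  then obtain i where i: "i \<in> I" "\<psi> i = Suc m" using series_label[OF A_series] by (metis Suc_le_eq)
  then have "A m \<sqsubseteq> A (Suc m)" using A_covers[OF i(1)] unfolding covers_def by simp
  then show ?case using step by (meson A_closed Suc_leD le_trans less_imp_le order_trans)
qed

text \<open>
The label \<open>i\<close> belongs to \<open>x\<close> if the \<open>i\<close>-th factor of the series that \<open>A\<close> induces on \<open>x\<close> does not vanish,
that is, if \<open>x \<sqinter> A (\<psi> i) \<noteq> x \<sqinter> A (\<psi> i - 1)\<close>; as \<open>A\<close> increases, this is the failure of one inequality.
\<close>

definition labels :: "'a \<Rightarrow> 'i set" where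
  "labels x = {i \<in> I. \<not> x \<sqinter> A (\<psi> i) \<sqsubseteq> A (\<psi> i - 1)}"

lemma labels_subset: "labels x \<subseteq> I"
  unfolding labels_def by blast

lemma finite_labels: "finite (labels x)"
  using finite_I labels_subset finite_subset by blast

lemma labels_mono:
  assumes "x \<in> carrier L" "y \<in> carrier L" "x \<sqsubseteq> y" shows "labels x \<subseteq> labels y"
proof
  fix i assume "i \<in> labels x"
  then have i: "i \<in> I" "\<not> x \<sqinter> A (\<psi> i) \<sqsubseteq> A (\<psi> i - 1)" unfolding labels_def by auto
  have "x \<sqinter> A (\<psi> i) \<sqsubseteq> y \<sqinter> A (\<psi> i)"
    using assms i by (simp add: le_meet_iff meet_le1 meet_le2)
  then have "\<not> y \<sqinter> A (\<psi> i) \<sqsubseteq> A (\<psi> i - 1)"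
    using i assms le_trans[of "x \<sqinter> A (\<psi> i)" "y \<sqinter> A (\<psi> i)" "A (\<psi> i - 1)"] by auto
  then show "i \<in> labels y" using i unfolding labels_def by blast
qed

text \<open>
If the \<open>i\<close>-th induced factor does not vanish, then \<open>x \<sqinter> A (\<psi> i)\<close> and \<open>A (\<psi> i - 1)\<close> span \<open>A (\<psi> i)\<close>, so the
induced step is the transpose of the step of \<open>A\<close>.
\<close>

lemma labels_step:
  assumes x: "x \<in> carrier L" and i: "i \<in> labels x"
  shows "step i (x \<sqinter> A (\<psi> i - 1)) (x \<sqinter> A (\<psi> i))"
    and "covers (x \<sqinter> A (\<psi> i - 1)) (x \<sqinter> A (\<psi> i))"
proof -
  let ?a = "A (\<psi> i - 1)" and ?b = "A (\<psi> i)"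
  let ?u = "x \<sqinter> ?b"
  have iI: "i \<in> I" and nle: "\<not> ?u \<sqsubseteq> ?a" using i unfolding labels_def by auto
  have ab [simp]: "?a \<in> carrier L" "?b \<in> carrier L" "?u \<in> carrier L" "A (\<psi> i - Suc 0) \<in> carrier L"
    using iI x A_index by simp_all
  have ale: "?a \<sqsubseteq> ?b" using A_covers[OF iI] unfolding covers_def by blast
  have m: "?u \<sqinter> ?a = x \<sqinter> ?a"
  proof (rule le_antisym)
    show "?u \<sqinter> ?a \<sqsubseteq> x \<sqinter> ?a" using x ab
      by (simp add: le_meet_iff meet_le1 meet_le2)
    show "x \<sqinter> ?a \<sqsubseteq> ?u \<sqinter> ?a" using x ab ale
      by (simp add: le_meet_iff meet_le1 meet_le2)
  qed (use x ab in auto)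
  have j: "?u \<squnion> ?a = ?b"
    using A_covers[OF iI]
  proof (rule covers_cases)
    show "?u \<squnion> ?a \<in> carrier L" "?a \<sqsubseteq> ?u \<squnion> ?a" using ab by (simp_all add: join_right)
    show "?u \<squnion> ?a \<sqsubseteq> ?b" using x ab ale by (simp add: join_le_iff meet_right)
    assume "?u \<squnion> ?a = ?a"
    then show ?thesis using nle ab by (metis join_left)
  qed
  have c: "covers (?u \<sqinter> ?a) ?u"
    using covers_transpose[of ?u ?a] j A_covers[OF iI] ab by simp
  then show "covers (x \<sqinter> ?a) ?u" using m by simp
  show "step i (x \<sqinter> ?a) ?u"
    using step_transpose[OF iI ab(3) ab(1) c] j m A_step[OF iI] by simp
qed

text \<open>
Climb along \<open>A\<close>: the parts of \<open>x\<close> and \<open>y\<close> below \<open>A k\<close> agree for every \<open>k\<close>, because each induced step of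
\<open>y\<close> is a cover and \<open>x\<close> moves whenever \<open>y\<close> does.
\<close>

lemma eq_if_labels_subset:
  assumes x: "x \<in> carrier L" and y: "y \<in> carrier L" and le: "x \<sqsubseteq> y" and sub: "labels y \<subseteq> labels x"
  shows "x = y"
proof -
  have "k \<le> n \<Longrightarrow> y \<sqinter> A k \<sqsubseteq> x" for k
  proof (induction k)
    case 0
    have "A 0 = \<bottom>" using A_series unfolding series_def by blast
    then show ?case using x y by (simp add: meet_le2)
  next
    case (Suc k)
    then obtain i where i: "i \<in> I" "\<psi> i = Suc k"
      using series_label[OF A_series] by (metis Suc_le_eq)
    have kn: "k \<le> n" using Suc.prems by simp
    have cl: "A k \<in> carrier L" "A (Suc k) \<in> carrier L" using Suc.prems by auto
    have IH: "y \<sqinter> A k \<sqsubseteq> x" using Suc.IH kn .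
    show ?case
    proof (cases "i \<in> labels y")
      case False
      then have "y \<sqinter> A (Suc k) \<sqsubseteq> A k" using i unfolding labels_def by simp
      then have "y \<sqinter> A (Suc k) \<sqsubseteq> y \<sqinter> A k" using y cl by (simp add: le_meet_iff meet_left)
      then show ?thesis using le_trans[OF _ IH] x y cl by simp
    next
      case True
      have c: "covers (y \<sqinter> A k) (y \<sqinter> A (Suc k))" using labels_step(2)[OF y True] i by simp
      have nle: "\<not> x \<sqinter> A (Suc k) \<sqsubseteq> A k" using True sub i unfolding labels_def by auto
      have "x \<sqinter> A (Suc k) = y \<sqinter> A (Suc k)"
        using c
      proof (rule covers_cases)
        show "x \<sqinter> A (Suc k) \<in> carrier L" using x cl by simp
        show "y \<sqinter> A k \<sqsubseteq> x \<sqinter> A (Suc k)"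
          using IH x y cl A_mono[of k "Suc k"] Suc.prems by (simp add: le_meet_iff meet_le2)
        show "x \<sqinter> A (Suc k) \<sqsubseteq> y \<sqinter> A (Suc k)"
          using le x y cl by (simp add: le_meet_iff meet_le1 meet_right)
        assume "x \<sqinter> A (Suc k) = y \<sqinter> A k"
        then show ?thesis using nle y cl by (metis meet_right)
      qed
      then show ?thesis using x cl by (metis meet_left)
    qed
  qed
  then have "y \<sqinter> A n \<sqsubseteq> x" by blast
  moreover have "A n = \<top>" using A_series unfolding series_def by blast
  ultimately have "y \<sqsubseteq> x" using y meet_top_eq by simp
  then show ?thesis using le x y by (metis le_antisym)
qed

text \<open>
The Jordan--Hoelder step. Let \<open>k\<close> be the first index at which \<open>y \<sqinter> A k\<close> leaves \<open>x\<close>. Up to there \<open>x\<close> and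
\<open>y\<close> induce the same factors; beyond it \<open>y = (y \<sqinter> A l) \<squnion> x\<close>, so modularity turns a vanishing factor of
\<open>x\<close> into a vanishing factor of \<open>y\<close>; and at \<open>k\<close> itself \<open>y\<close> has a factor which is a transpose of the
step from \<open>x\<close> to \<open>y\<close>, while the factor of \<open>x\<close> vanishes.
\<close>

lemma labels_covers:
  assumes x: "x \<in> carrier L" and y: "y \<in> carrier L" and c: "covers x y"
  obtains i where "i \<in> I" "step i x y" "i \<notin> labels x" "labels y = insert i (labels x)"
proof -
  have le: "x \<sqsubseteq> y" and ne: "x \<noteq> y" using c unfolding covers_def by auto
  have A0: "A 0 = \<bottom>" and An: "A n = \<top>" using A_series unfolding series_def by auto
  let ?P = "\<lambda>k. \<not> y \<sqinter> A k \<sqsubseteq> x"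
  define k where "k = (LEAST k. ?P k)"
  have Pn: "?P n"
  proof
    assume "y \<sqinter> A n \<sqsubseteq> x"
    then have "y \<sqsubseteq> x" using y An meet_top_eq by simp
    then show False using le ne x y by (metis le_antisym)
  qed
  have Pk: "?P k" unfolding k_def by (rule LeastI[of ?P, OF Pn])
  have kn: "k \<le> n" unfolding k_def by (rule Least_le[of ?P, OF Pn])
  have less: "y \<sqinter> A l \<sqsubseteq> x" if "l < k" for l using that not_less_Least unfolding k_def by blast
  have "k \<noteq> 0"
  proof
    assume "k = 0"
    then show False using Pk A0 x y by (simp add: meet_le2)
  qed
  then obtain i where i: "i \<in> I" "\<psi> i = k"
    using series_label[OF A_series, of "k - 1"] kn by (metis One_nat_def Suc_pred diff_Suc_less le_0_eq less_le_trans not_gr_zero)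
  let ?a = "A (k - 1)" and ?b = "A k"
  have cl [simp]: "?a \<in> carrier L" "?b \<in> carrier L" "A (k - Suc 0) \<in> carrier L"
    using kn by (simp_all add: le_diff_conv)
  have ab: "?a \<sqsubseteq> ?b" using A_mono kn by simp
  have ya: "y \<sqinter> ?a \<sqsubseteq> x" using less \<open>k \<noteq> 0\<close> by simp
  have iy: "i \<in> labels y"
  proof (rule ccontr)
    assume "i \<notin> labels y"
    then have "y \<sqinter> ?b \<sqsubseteq> ?a" using i unfolding labels_def by simp
    then have "y \<sqinter> ?b \<sqsubseteq> y \<sqinter> ?a" using y by (simp add: le_meet_iff meet_left)
    then show False using Pk le_trans[OF _ ya] x y by simp
  qed
  have xb: "x \<sqinter> ?b = y \<sqinter> ?a"
    using labels_step(2)[OF y iy, unfolded i(2)]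
  proof (rule covers_cases)
    show "x \<sqinter> ?b \<in> carrier L" using x by simp
    show "y \<sqinter> ?a \<sqsubseteq> x \<sqinter> ?b" using ya ab x y by (simp add: le_meet_iff meet_le1 meet_le2)
    show "x \<sqinter> ?b \<sqsubseteq> y \<sqinter> ?b" using le x y by (simp add: le_meet_iff meet_le1 meet_le2)
    assume "x \<sqinter> ?b = y \<sqinter> ?b"
    then show ?thesis using Pk x by (metis cl(2) meet_left)
  qed
  have ix: "i \<notin> labels x"
    using xb i y unfolding labels_def by (simp add: meet_right)
  let ?u = "y \<sqinter> ?b"
  have u: "?u \<in> carrier L" using y by simp
  have um: "?u \<sqinter> x = y \<sqinter> ?a"
  proof -
    have "?u \<sqinter> x = x \<sqinter> ?b"
    proof (rule le_antisym)
      show "?u \<sqinter> x \<sqsubseteq> x \<sqinter> ?b" using x y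
        by (simp add: le_meet_iff meet_le1 meet_le2)
      show "x \<sqinter> ?b \<sqsubseteq> ?u \<sqinter> x" using x y le
        by (simp add: le_meet_iff meet_le1 meet_le2)
    qed (use x y in auto)
    then show ?thesis using xb by simp
  qed
  have uj: "?u \<squnion> x = y"
    using c
  proof (rule covers_cases)
    show "?u \<squnion> x \<in> carrier L" using x y by simp
    show "x \<sqsubseteq> ?u \<squnion> x" using u x by (simp add: join_right)
    show "?u \<squnion> x \<sqsubseteq> y" using u x y le by (simp add: join_le_iff meet_left)
    assume "?u \<squnion> x = x"
    then show ?thesis using Pk u x by (metis join_left)
  qed
  have "covers (?u \<sqinter> x) ?u" "step i (?u \<sqinter> x) ?u"
    using labels_step[OF y iy] um i by simp_all
  then have f: "step i x y" using step_transpose[OF i(1) u x] uj by simp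
  have "j \<in> labels x" if j: "j \<in> labels y" "j \<noteq> i" for j
  proof (rule ccontr)
    assume "j \<notin> labels x"
    let ?c = "A (\<psi> j - 1)" and ?d = "A (\<psi> j)"
    have jI: "j \<in> I" and nle: "\<not> y \<sqinter> ?d \<sqsubseteq> ?c" using j unfolding labels_def by auto
    have xd: "x \<sqinter> ?d \<sqsubseteq> ?c" using \<open>j \<notin> labels x\<close> jI unfolding labels_def by simp
    have cd [simp]: "?c \<in> carrier L" "?d \<in> carrier L" "A (\<psi> j - Suc 0) \<in> carrier L"
      using A_index jI by simp_all
    have "\<psi> j \<noteq> k"
      using A_series i jI j(2) unfolding series_def bij_betw_def inj_on_def by auto
    then consider "\<psi> j < k" | "k \<le> \<psi> j - 1" by linarith
    then show False
    proof cases
      case 1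
      then have "y \<sqinter> ?d \<sqsubseteq> x" by (rule less)
      then have "y \<sqinter> ?d \<sqsubseteq> x \<sqinter> ?d" using x y by (simp add: le_meet_iff meet_right)
      then show False using le_trans[OF _ xd] nle x y by simp
    next
      case 2
      have kc: "?b \<sqsubseteq> ?c" using A_mono[OF 2] \<psi>_le[OF jI] by linarith
      have cd_le: "?c \<sqsubseteq> ?d" using A_mono[of "\<psi> j - 1" "\<psi> j"] \<psi>_le[OF jI] by simp
      have j: "(y \<sqinter> ?c) \<squnion> x = y"
        using c
      proof (rule covers_cases)
        show "(y \<sqinter> ?c) \<squnion> x \<in> carrier L" using x y by simp
        show "x \<sqsubseteq> (y \<sqinter> ?c) \<squnion> x" using x y by (simp add: join_right)
        show "(y \<sqinter> ?c) \<squnion> x \<sqsubseteq> y" using x y le by (simp add: join_le_iff meet_left)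
        assume "(y \<sqinter> ?c) \<squnion> x = x"
        then have "y \<sqinter> ?c \<sqsubseteq> x" using x y by (metis cd(1) join_left meet_closed)
        moreover have "?u \<sqsubseteq> y \<sqinter> ?c" using kc x y
          by (simp add: le_meet_iff meet_le1 meet_le2)
        ultimately show ?thesis using Pk le_trans[of ?u "y \<sqinter> ?c" x] x y by simp
      qed
      have "((y \<sqinter> ?c) \<squnion> x) \<sqinter> ?d \<sqsubseteq> (y \<sqinter> ?c) \<squnion> (x \<sqinter> ?d)"
        using x y cd_le by (simp add: modular meet_le2)
      moreover have "(y \<sqinter> ?c) \<squnion> (x \<sqinter> ?d) \<sqsubseteq> ?c" using x y xd by (simp add: join_le_iff meet_right)
      ultimately have "((y \<sqinter> ?c) \<squnion> x) \<sqinter> ?d \<sqsubseteq> ?c"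
        using le_trans[of "((y \<sqinter> ?c) \<squnion> x) \<sqinter> ?d" "(y \<sqinter> ?c) \<squnion> (x \<sqinter> ?d)" ?c] x y by simp
      then show False using nle j by simp
    qed
  qed
  then have "labels y = insert i (labels x)" using labels_mono[OF x y le] iy by blast
  then show thesis using that i f ix by blast
qed

text \<open>
A label \<open>i\<close> of both \<open>x\<close> and \<open>y\<close> that is missing in \<open>x \<sqinter> y\<close> would occur twice below \<open>x \<squnion> y\<close>: put
\<open>a = A (\<psi> i - 1)\<close> and \<open>b = A (\<psi> i)\<close>. As \<open>x \<sqinter> y \<sqinter> b \<sqsubseteq> a\<close>, the step from \<open>y \<sqinter> a\<close> to \<open>y \<sqinter> b\<close>, of label
\<open>i\<close>, transposes to a step out of \<open>(y \<sqinter> a) \<squnion> (x \<sqinter> b)\<close>. By \<open>labels_covers\<close> that element lacks the label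
\<open>i\<close>, although \<open>x \<sqinter> b\<close> below it has the label \<open>i\<close>.
\<close>

lemma labels_meet:
  assumes x: "x \<in> carrier L" and y: "y \<in> carrier L"
  shows "labels (x \<sqinter> y) = labels x \<inter> labels y"
proof
  show "labels (x \<sqinter> y) \<subseteq> labels x \<inter> labels y"
    using labels_mono x y by (simp add: meet_left meet_right)
  show "labels x \<inter> labels y \<subseteq> labels (x \<sqinter> y)"
  proof (rule ccontr)
    assume "\<not> ?thesis"
    then obtain i where ix: "i \<in> labels x" and iy: "i \<in> labels y" and nm: "i \<notin> labels (x \<sqinter> y)"
      by blast
    let ?a = "A (\<psi> i - 1)" and ?b = "A (\<psi> i)"
    have iI: "i \<in> I" using ix labels_subset by blast
    have cl [simp]: "?a \<in> carrier L" "?b \<in> carrier L" "A (\<psi> i - Suc 0) \<in> carrier L"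
      using iI A_index by simp_all
    have ab: "?a \<sqsubseteq> ?b" using A_covers[OF iI] unfolding covers_def by blast
    have xy: "(x \<sqinter> y) \<sqinter> ?b \<sqsubseteq> ?a" using nm iI unfolding labels_def by simp
    let ?u = "(y \<sqinter> ?a) \<squnion> (x \<sqinter> ?b)" and ?v = "y \<sqinter> ?b"
    have uv [simp]: "?u \<in> carrier L" "?v \<in> carrier L" using x y by simp_all
    have yab: "y \<sqinter> ?a \<sqsubseteq> ?v" using y ab
      by (simp add: le_meet_iff meet_le1 meet_le2)
    have "?v \<sqinter> ?u = y \<sqinter> ?a"
    proof (rule le_antisym)
      have "(x \<sqinter> ?b) \<sqinter> ?v \<sqsubseteq> (x \<sqinter> y) \<sqinter> ?b" using x y
        by (simp add: le_meet_iff meet_le1 meet_le2)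
      then have "(x \<sqinter> ?b) \<sqinter> ?v \<sqsubseteq> ?a" using le_trans[OF _ xy] x y by simp
      then have "(x \<sqinter> ?b) \<sqinter> ?v \<sqsubseteq> y \<sqinter> ?a" using x y
        by (simp add: le_meet_iff meet_le1 meet_le2)
      then have "(y \<sqinter> ?a) \<squnion> ((x \<sqinter> ?b) \<sqinter> ?v) \<sqsubseteq> y \<sqinter> ?a" using x y by (simp add: join_le_iff)
      moreover have "?u \<sqinter> ?v \<sqsubseteq> (y \<sqinter> ?a) \<squnion> ((x \<sqinter> ?b) \<sqinter> ?v)"
        using yab x y by (simp add: modular)
      ultimately have "?u \<sqinter> ?v \<sqsubseteq> y \<sqinter> ?a"
        using le_trans[of "?u \<sqinter> ?v" "(y \<sqinter> ?a) \<squnion> ((x \<sqinter> ?b) \<sqinter> ?v)" "y \<sqinter> ?a"] x y by simp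
      then show "?v \<sqinter> ?u \<sqsubseteq> y \<sqinter> ?a" by (simp add: meet_comm)
      show "y \<sqinter> ?a \<sqsubseteq> ?v \<sqinter> ?u" using yab x y by (simp add: le_meet_iff join_left)
    qed (use x y in auto)
    then have c: "covers (?v \<sqinter> ?u) ?v" and f: "step i (?v \<sqinter> ?u) ?v"
      using labels_step[OF y iy] by simp_all
    have c': "covers ?u (?v \<squnion> ?u)" using c covers_transpose uv by blast
    have f': "step i ?u (?v \<squnion> ?u)" using f step_transpose[OF iI uv(2,1) c] by blast
    obtain j where j: "j \<in> I" "step j ?u (?v \<squnion> ?u)" "j \<notin> labels ?u"
      using labels_covers[OF _ _ c'] uv by (metis join_closed)
    then have "i \<notin> labels ?u" using step_unique[OF iI j(1) f'] by blast
    moreover have "i \<in> labels (x \<sqinter> ?b)"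
    proof -
      have "x \<sqinter> ?b \<sqsubseteq> (x \<sqinter> ?b) \<sqinter> ?b" using x by (simp add: le_meet_iff meet_right)
      moreover have "\<not> x \<sqinter> ?b \<sqsubseteq> ?a" using ix unfolding labels_def by blast
      ultimately have "\<not> (x \<sqinter> ?b) \<sqinter> ?b \<sqsubseteq> ?a"
        using le_trans[of "x \<sqinter> ?b" "(x \<sqinter> ?b) \<sqinter> ?b" ?a] x by auto
      then show ?thesis using iI unfolding labels_def by blast
    qed
    moreover have "labels (x \<sqinter> ?b) \<subseteq> labels ?u" using x y by (simp add: labels_mono join_right)
    ultimately show False by blast
  qed
qed

lemma le_iff_labels:
  assumes x: "x \<in> carrier L" and y: "y \<in> carrier L"
  shows "x \<sqsubseteq> y \<longleftrightarrow> labels x \<subseteq> labels y"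
proof
  assume "labels x \<subseteq> labels y"
  then have "labels x \<subseteq> labels (x \<sqinter> y)" using labels_meet[OF x y] by blast
  then have "x \<sqinter> y = x" using eq_if_labels_subset[of "x \<sqinter> y" x] x y by (simp add: meet_left)
  then show "x \<sqsubseteq> y" using x y by (metis meet_right)
qed (use assms labels_mono in blast)

lemma labels_inject:
  assumes "x \<in> carrier L" "y \<in> carrier L" "labels x = labels y"
  shows "x = y"
  using assms le_iff_labels by (metis le_antisym order_refl)

text \<open>
There is no room for an intermediate label set, and label sets determine elements.
\<close>

lemma covers_if_labels_insert:
  assumes x: "x \<in> carrier L" and y: "y \<in> carrier L"
    and ins: "labels y = insert i (labels x)" "i \<notin> labels x"
  shows "covers x y"
proof (rule coversI)
  show "x \<sqsubseteq> y" using le_iff_labels x y ins by blast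
  show "x \<noteq> y" using ins by blast
  fix z assume z: "z \<in> carrier L" "x \<sqsubseteq> z" "z \<sqsubseteq> y" "z \<noteq> x"
  then have "labels x \<subseteq> labels z" "labels z \<subseteq> labels y" "labels z \<noteq> labels x"
    using le_iff_labels labels_inject x y by auto
  then have "labels z = labels y" using ins by auto
  then show "z = y" using labels_inject z y by blast
qed

lemma labels_bottom: "labels \<bottom> = {}"
proof -
  have "\<bottom> \<sqinter> A (\<psi> i) \<sqsubseteq> A (\<psi> i - 1)" if "i \<in> I" for i
    using A_index[OF that] by (simp add: meet_le1)
  then show ?thesis unfolding labels_def by blast
qed

lemma labels_top: "labels \<top> = I"
proof -
  have "\<not> \<top> \<sqinter> A (\<psi> i) \<sqsubseteq> A (\<psi> i - 1)" if i: "i \<in> I" for i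
  proof
    assume "\<top> \<sqinter> A (\<psi> i) \<sqsubseteq> A (\<psi> i - 1)"
    moreover have "A (\<psi> i) \<sqsubseteq> \<top> \<sqinter> A (\<psi> i)" using A_index[OF i] by (simp add: le_meet_iff)
    ultimately have "A (\<psi> i) \<sqsubseteq> A (\<psi> i - 1)"
      using A_index[OF i] le_trans[of "A (\<psi> i)" "\<top> \<sqinter> A (\<psi> i)" "A (\<psi> i - 1)"] by simp
    then show False using A_covers[OF i] A_index[OF i] unfolding covers_def by (metis le_antisym)
  qed
  then show ?thesis unfolding labels_def by blast
qed

lemma series_labels:
  assumes B: "series B \<phi>" and k: "k \<le> n"
  shows "labels (B k) = {i \<in> I. \<phi> i \<le> k}"
  using k
proof (induction k)
  case 0
  have "\<phi> ` I = {1..n}" "B 0 = \<bottom>" using B unfolding series_def bij_betw_def by auto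
  then show ?case using labels_bottom by fastforce
next
  case (Suc k)
  then obtain i where i: "i \<in> I" "\<phi> i = Suc k" "step i (B k) (B (Suc k))"
    using series_label[OF B] by (metis Suc_le_eq)
  have cl: "B k \<in> carrier L" "B (Suc k) \<in> carrier L" using B Suc.prems unfolding series_def by auto
  have c: "covers (B k) (B (Suc k))" using step_covers i cl by blast
  obtain j where j: "j \<in> I" "step j (B k) (B (Suc k))" "labels (B (Suc k)) = insert j (labels (B k))"
    using labels_covers[OF cl c] by metis
  have "j = i" using step_unique i j by blast
  then have lab: "labels (B (Suc k)) = insert i {i \<in> I. \<phi> i \<le> k}" using j Suc by simp
  have inj: "inj_on \<phi> I" using B unfolding series_def bij_betw_def by blast
  have "l = i" if "l \<in> I" "\<phi> l = Suc k" for l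
    using inj_onD[OF inj _ that(1) i(1)] that(2) i(2) by simp
  then show ?case unfolding lab le_Suc_eq using i by blast
qed

lemma series_unique:
  assumes "series B \<phi>" "series B' \<phi>" "k \<le> n"
  shows "B k = B' k"
proof (rule labels_inject)
  show "B k \<in> carrier L" "B' k \<in> carrier L" using assms unfolding series_def by blast+
  show "labels (B k) = labels (B' k)" using assms by (simp add: series_labels)
qed

text \<open>
The elements having the label \<open>j\<close> are closed under meets by \<open>labels_meet\<close>, and there are only finitely
many label sets; one with fewest labels is therefore the least.
\<close>

lemma least_with_label:
  assumes "j \<in> I"
  obtains x where "x \<in> carrier L" "j \<in> labels x"
    "\<And>y. y \<in> carrier L \<Longrightarrow> j \<in> labels y \<Longrightarrow> x \<sqsubseteq> y"
proof -
  have "\<exists>x. (x \<in> carrier L \<and> j \<in> labels x) \<and>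
      (\<forall>y. y \<in> carrier L \<and> j \<in> labels y \<longrightarrow> card (labels x) \<le> card (labels y))"
    by (rule ex_has_least_nat[of _ \<top>]) (use labels_top assms in simp)
  then obtain x where x: "x \<in> carrier L" "j \<in> labels x"
    and least: "\<And>y. y \<in> carrier L \<Longrightarrow> j \<in> labels y \<Longrightarrow> card (labels x) \<le> card (labels y)"
    by blast
  have "x \<sqsubseteq> y" if y: "y \<in> carrier L" "j \<in> labels y" for y
  proof -
    have "card (labels x) \<le> card (labels x \<inter> labels y)"
      using least[of "x \<sqinter> y"] x y labels_meet by simp
    then have "labels x \<inter> labels y = labels x"
      using card_seteq[OF finite_labels, of "labels x \<inter> labels y" x] by blast
    then show ?thesis using le_iff_labels x y by blast
  qed
  then show thesis using that x by blast
qed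

text \<open>
If \<open>x\<close> realizes \<open>{i. \<phi> i \<le> k}\<close> and \<open>m\<close> is least with the label \<open>j\<close> at position \<open>k + 1\<close>, then monotonicity
of \<open>\<phi>\<close> leaves \<open>j\<close> as the only label of \<open>m\<close> not in \<open>x\<close>. Thus \<open>m\<close> covers \<open>m \<sqinter> x\<close>, and by transposition
\<open>m \<squnion> x\<close> covers \<open>x\<close>, adding just one label.
\<close>

lemma ex_labels_initial:
  assumes \<phi>: "bij_betw \<phi> I {1..n}"
    and mono: "\<And>i j. \<lbrakk>i \<in> I; j \<in> I; \<And>B \<chi>. series B \<chi> \<Longrightarrow> \<chi> i \<le> \<chi> j\<rbrakk> \<Longrightarrow> \<phi> i \<le> \<phi> j"
    and k: "k \<le> n"
  shows "\<exists>x\<in>carrier L. labels x = {i \<in> I. \<phi> i \<le> k}"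
  using k
proof (induction k)
  case 0
  have "\<phi> ` I = {1..n}" using \<phi> unfolding bij_betw_def by auto
  then show ?case using labels_bottom by (intro bexI[of _ \<bottom>]) fastforce+
next
  case (Suc k)
  then obtain x where x: "x \<in> carrier L" "labels x = {i \<in> I. \<phi> i \<le> k}" by auto
  have "Suc k \<in> \<phi> ` I" using \<phi> Suc.prems unfolding bij_betw_def by simp
  then obtain j where j: "j \<in> I" "\<phi> j = Suc k" by auto
  have only_j: "i = j" if "i \<in> I" "\<phi> i = Suc k" for i
    using \<phi> that j unfolding bij_betw_def inj_on_def by auto
  obtain m where m: "m \<in> carrier L" "j \<in> labels m"
    and least: "\<And>y. y \<in> carrier L \<Longrightarrow> j \<in> labels y \<Longrightarrow> m \<sqsubseteq> y"
    using least_with_label[OF j(1)] by metis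
  \<comment> \<open>Every series has reached \<open>m\<close> when it has collected \<open>j\<close>, and with \<open>m\<close> all labels of \<open>m\<close>.\<close>
  have below: "\<phi> i \<le> Suc k" if i: "i \<in> labels m" for i
  proof -
    have "\<chi> i \<le> \<chi> j" if B: "series B \<chi>" for B \<chi>
    proof -
      have le: "\<chi> j \<le> n" using B j unfolding series_def bij_betw_def by auto
      then have le': "B (\<chi> j) \<in> carrier L" using B unfolding series_def by blast
      have "j \<in> labels (B (\<chi> j))" using series_labels[OF B] le j by simp
      then have "labels m \<subseteq> labels (B (\<chi> j))" using least le' m labels_mono by blast
      then show ?thesis using i series_labels[OF B le] by blast
    qed
    then show ?thesis using mono[of i j] i j labels_subset by auto
  qed
  have "labels m = insert j (labels (m \<sqinter> x))"
    using below only_j m(2) labels_subset[of m]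
    unfolding labels_meet[OF m(1) x(1)] x(2) le_Suc_eq by blast
  moreover have "j \<notin> labels (m \<sqinter> x)" using labels_meet[OF m(1) x(1)] x j by simp
  ultimately have "covers (m \<sqinter> x) m" using covers_if_labels_insert m x by simp
  then have c: "covers x (m \<squnion> x)" using covers_transpose m x by blast
  obtain i where i: "i \<notin> labels x" "labels (m \<squnion> x) = insert i (labels x)"
    using labels_covers[OF _ _ c] m x by (metis join_closed)
  have "j \<in> labels (m \<squnion> x)" using labels_mono[of m "m \<squnion> x"] m x by (auto simp: join_left)
  then have "i = j" using i x j by auto
  then have "labels (m \<squnion> x) = insert j {i \<in> I. \<phi> i \<le> k}" using i(2) x(2) by simp
  also have "\<dots> = {i \<in> I. \<phi> i \<le> Suc k}" using j only_j unfolding le_Suc_eq by blast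
  finally have "labels (m \<squnion> x) = {i \<in> I. \<phi> i \<le> Suc k}" .
  then show ?case using m x by (intro bexI[of _ "m \<squnion> x"]) simp_all
qed

theorem ex_series:
  assumes \<phi>: "bij_betw \<phi> I {1..n}"
    and mono: "\<And>i j. \<lbrakk>i \<in> I; j \<in> I; \<And>B \<chi>. series B \<chi> \<Longrightarrow> \<chi> i \<le> \<chi> j\<rbrakk> \<Longrightarrow> \<phi> i \<le> \<phi> j"
  shows "\<exists>B. series B \<phi>"
proof -
  have "\<forall>k. \<exists>x. k \<le> n \<longrightarrow> x \<in> carrier L \<and> labels x = {i \<in> I. \<phi> i \<le> k}"
    using ex_labels_initial[OF \<phi> mono] by blast
  then obtain B where B: "\<And>k. k \<le> n \<Longrightarrow> B k \<in> carrier L"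
      "\<And>k. k \<le> n \<Longrightarrow> labels (B k) = {i \<in> I. \<phi> i \<le> k}"
    by metis
  have ran: "1 \<le> \<phi> i \<and> \<phi> i \<le> n" if "i \<in> I" for i using \<phi> that unfolding bij_betw_def by auto
  have "B 0 = \<bottom>" using labels_inject[of "B 0" \<bottom>] B[of 0] labels_bottom ran by fastforce
  moreover have "B n = \<top>" using labels_inject[of "B n" \<top>] B[of n] labels_top ran by auto
  moreover have "step i (B (\<phi> i - 1)) (B (\<phi> i))" if i: "i \<in> I" for i
  proof -
    have cl: "B (\<phi> i - 1) \<in> carrier L" "B (\<phi> i) \<in> carrier L"
      using B(1) ran[OF i] by (simp_all add: le_diff_conv)
    have lab: "labels (B (\<phi> i - 1)) = {j \<in> I. \<phi> j \<le> \<phi> i - 1}" "labels (B (\<phi> i)) = {j \<in> I. \<phi> j \<le> \<phi> i}"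
      using B(2) ran[OF i] by (simp_all add: le_diff_conv)
    have "j = i" if "j \<in> I" "\<phi> j = \<phi> i" for j
      using \<phi> that i unfolding bij_betw_def inj_on_def by auto
    then have ins: "labels (B (\<phi> i)) = insert i (labels (B (\<phi> i - 1)))" "i \<notin> labels (B (\<phi> i - 1))"
    proof -
      have le: "\<phi> j \<le> \<phi> i - 1 \<longleftrightarrow> \<phi> j \<le> \<phi> i \<and> \<phi> j \<noteq> \<phi> i" for j
        using ran[OF i] by linarith
      show "labels (B (\<phi> i)) = insert i (labels (B (\<phi> i - 1)))" "i \<notin> labels (B (\<phi> i - 1))"
        unfolding lab le using i \<open>\<And>j. \<lbrakk>j \<in> I; \<phi> j = \<phi> i\<rbrakk> \<Longrightarrow> j = i\<close> by blast+
    qed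
    have "covers (B (\<phi> i - 1)) (B (\<phi> i))" using covers_if_labels_insert[OF cl ins] .
    then obtain j where "j \<in> I" "step j (B (\<phi> i - 1)) (B (\<phi> i))" "j \<notin> labels (B (\<phi> i - 1))"
        "labels (B (\<phi> i)) = insert j (labels (B (\<phi> i - 1)))"
      using labels_covers[OF cl] by metis
    then show ?thesis using ins by auto
  qed
  ultimately have "series B \<phi>" unfolding series_def using \<phi> B(1) by blast
  then show ?thesis by blast
qed

end

section \<open>Arrows and factorization through arrows\<close>

context category
begin

abbreviation factors (infix "\<preceq>" 50) where "i \<preceq> j \<equiv> factors_through C i j"

lemma HomD: assumes "f \<in> Hom C a b" shows "f \<in> Arr C" "Dom C f = a" "Cod C f = b"
  using assms unfolding Hom_def by auto

lemma Hom_obj: assumes "f \<in> Hom C a b" shows "a \<in> Obj C" "b \<in> Obj C"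
  using assms dom_obj cod_obj unfolding Hom_def by auto

lemma monic_iff:
  assumes "f \<in> Hom C a b"
  shows "monic C f \<longleftrightarrow> (\<forall>w. \<forall>g\<in>Hom C w a. \<forall>h\<in>Hom C w a. f \<odot> g = f \<odot> h \<longrightarrow> g = h)"
  using HomD[OF assms] unfolding monic_def by simp

lemma epic_iff:
  assumes "f \<in> Hom C a b"
  shows "epic C f \<longleftrightarrow> (\<forall>w. \<forall>g\<in>Hom C b w. \<forall>h\<in>Hom C b w. g \<odot> f = h \<odot> f \<longrightarrow> g = h)"
  using HomD[OF assms] unfolding epic_def by simp

lemma monicD:
  "\<lbrakk>monic C f; f \<in> Hom C a b; g \<in> Hom C w a; h \<in> Hom C w a; f \<odot> g = f \<odot> h\<rbrakk> \<Longrightarrow> g = h"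
  using monic_iff by blast

lemma epicD:
  "\<lbrakk>epic C f; f \<in> Hom C a b; g \<in> Hom C b w; h \<in> Hom C b w; g \<odot> f = h \<odot> f\<rbrakk> \<Longrightarrow> g = h"
  using epic_iff by blast

lemma monic_comp:
  assumes f: "f \<in> Hom C a b" "monic C f" and g: "g \<in> Hom C b c" "monic C g"
  shows "monic C (g \<odot> f)"
  unfolding monic_iff[OF comp_hom[OF f(1) g(1)]]
proof (intro allI ballI impI)
  fix w h k assume h: "h \<in> Hom C w a" and k: "k \<in> Hom C w a" and "(g \<odot> f) \<odot> h = (g \<odot> f) \<odot> k"
  then have "g \<odot> (f \<odot> h) = g \<odot> (f \<odot> k)"
    using comp_assoc[OF h f(1) g(1)] comp_assoc[OF k f(1) g(1)] by simp
  then have "f \<odot> h = f \<odot> k" by (rule monicD[OF g(2,1) comp_hom[OF h f(1)] comp_hom[OF k f(1)]])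
  then show "h = k" by (rule monicD[OF f(2,1) h k])
qed

lemma epic_comp:
  assumes f: "f \<in> Hom C a b" "epic C f" and g: "g \<in> Hom C b c" "epic C g"
  shows "epic C (g \<odot> f)"
  unfolding epic_iff[OF comp_hom[OF f(1) g(1)]]
proof (intro allI ballI impI)
  fix w h k assume h: "h \<in> Hom C c w" and k: "k \<in> Hom C c w" and "h \<odot> (g \<odot> f) = k \<odot> (g \<odot> f)"
  then have "(h \<odot> g) \<odot> f = (k \<odot> g) \<odot> f"
    using comp_assoc[OF f(1) g(1) h] comp_assoc[OF f(1) g(1) k] by simp
  then have "h \<odot> g = k \<odot> g" by (rule epicD[OF f(2,1) comp_hom[OF g(1) h] comp_hom[OF g(1) k]])
  then show "h = k" by (rule epicD[OF g(2,1) h k])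
qed

lemma epic_cancel:
  assumes f: "f \<in> Hom C a b" and g: "g \<in> Hom C b c" and e: "epic C (g \<odot> f)"
  shows "epic C g"
  unfolding epic_iff[OF g]
proof (intro allI ballI impI)
  fix w h k assume h: "h \<in> Hom C c w" and k: "k \<in> Hom C c w" and "h \<odot> g = k \<odot> g"
  then have "h \<odot> (g \<odot> f) = k \<odot> (g \<odot> f)"
    using comp_assoc[OF f g h] comp_assoc[OF f g k] by simp
  then show "h = k" by (rule epicD[OF e comp_hom[OF f g] h k])
qed

lemma monic_cancel:
  assumes f: "f \<in> Hom C a b" and g: "g \<in> Hom C b c" and m: "monic C (g \<odot> f)"
  shows "monic C f"
  unfolding monic_iff[OF f]
proof (intro allI ballI impI)
  fix w h k assume h: "h \<in> Hom C w a" and k: "k \<in> Hom C w a" and "f \<odot> h = f \<odot> k"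
  then have "(g \<odot> f) \<odot> h = (g \<odot> f) \<odot> k"
    using comp_assoc[OF h f g] comp_assoc[OF k f g] by simp
  then show "h = k" by (rule monicD[OF m comp_hom[OF f g] h k])
qed

lemma ident_monic: "a \<in> Obj C \<Longrightarrow> monic C (Ident C a)"
  using monic_iff[OF ident_hom] ident_comp by metis

lemma ident_epic: "a \<in> Obj C \<Longrightarrow> epic C (Ident C a)"
  using epic_iff[OF ident_hom] comp_ident by metis

lemma factors_iff:
  assumes "i \<in> Hom C a x" "j \<in> Hom C b x"
  shows "i \<preceq> j \<longleftrightarrow> (\<exists>h\<in>Hom C a b. i = j \<odot> h)"
  using assms unfolding factors_through_def by (simp add: HomD)

lemma factors_refl: "i \<in> Hom C a x \<Longrightarrow> i \<preceq> i"
  using factors_iff comp_ident ident_hom Hom_obj by metis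

lemma factors_trans:
  assumes "i \<preceq> j" "j \<preceq> k" "i \<in> Hom C a x" "j \<in> Hom C b x" "k \<in> Hom C c x"
  shows "i \<preceq> k"
proof -
  obtain g h where g: "g \<in> Hom C a b" "i = j \<odot> g" and h: "h \<in> Hom C b c" "j = k \<odot> h"
    using assms factors_iff by meson
  then have "i = k \<odot> (h \<odot> g)" using comp_assoc[OF g(1) h(1) assms(5)] by simp
  then show ?thesis using factors_iff[OF assms(3,5)] comp_hom g h by blast
qed

lemma comp_factors_self: "\<lbrakk>j \<in> Hom C b x; g \<in> Hom C w b\<rbrakk> \<Longrightarrow> j \<odot> g \<preceq> j"
  using factors_iff comp_hom by blast

lemma factors_comp_right:
  "\<lbrakk>i \<preceq> j; i \<in> Hom C a x; j \<in> Hom C b x; g \<in> Hom C w a\<rbrakk> \<Longrightarrow> i \<odot> g \<preceq> j"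
  using factors_trans comp_factors_self comp_hom by meson

lemma factors_comp_left:
  assumes "i \<preceq> j" "i \<in> Hom C a x" "j \<in> Hom C b x" "q \<in> Hom C x y"
  shows "q \<odot> i \<preceq> q \<odot> j"
proof -
  obtain h where h: "h \<in> Hom C a b" "i = j \<odot> h" using assms factors_iff by meson
  then have "q \<odot> i = (q \<odot> j) \<odot> h" using comp_assoc[OF h(1) assms(3,4)] by simp
  then show ?thesis using comp_factors_self[OF comp_hom[OF assms(3,4)] h(1)] by simp
qed

lemma monic_comp_factors_iff:
  assumes i: "i \<in> Hom C a x" and j: "j \<in> Hom C b x" and m: "m \<in> Hom C x y" "monic C m"
  shows "m \<odot> i \<preceq> m \<odot> j \<longleftrightarrow> i \<preceq> j"
proof
  assume "m \<odot> i \<preceq> m \<odot> j"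
  then obtain h where h: "h \<in> Hom C a b" "m \<odot> i = (m \<odot> j) \<odot> h"
    using factors_iff[OF comp_hom[OF i m(1)] comp_hom[OF j m(1)]] by blast
  then have "m \<odot> i = m \<odot> (j \<odot> h)" using comp_assoc[OF h(1) j m(1)] by simp
  then have "i = j \<odot> h" by (rule monicD[OF m(2,1) i comp_hom[OF h(1) j]])
  then show "i \<preceq> j" using comp_factors_self[OF j h(1)] by simp
qed (rule factors_comp_left[OF _ i j m(1)])

end

context preadditive_category
begin

lemma zero_hom: "a \<in> Obj C \<Longrightarrow> b \<in> Obj C \<Longrightarrow> Zero C a b \<in> Hom C a b"
  using hom_comm_group[of a b] monoid.one_closed[of "Hom_group C a b"]
  unfolding comm_group_def group_def Hom_group_def by simp

lemma comp_zero:
  assumes f: "f \<in> Hom C b c" and a: "a \<in> Obj C"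
  shows "f \<odot> Zero C a b = Zero C a c"
proof -
  have o: "b \<in> Obj C" "c \<in> Obj C" using Hom_obj f by auto
  interpret G: comm_group "Hom_group C a b" using hom_comm_group a o by simp
  interpret H: comm_group "Hom_group C a c" using hom_comm_group a o by simp
  have z: "Zero C a b \<in> Hom C a b" using zero_hom a o by simp
  have "Zero C a b \<uplus> Zero C a b = Zero C a b"
    using G.l_one[of "Zero C a b"] z unfolding Hom_group_def by simp
  then have "(f \<odot> Zero C a b) \<uplus> (f \<odot> Zero C a b) = f \<odot> Zero C a b"
    using plus_comp[OF z z f] by simp
  then show ?thesis
    using H.l_cancel_one[of "f \<odot> Zero C a b" "f \<odot> Zero C a b"] comp_hom[OF z f]
    unfolding Hom_group_def by simp
qed

lemma zero_comp:
  assumes f: "f \<in> Hom C a b" and c: "c \<in> Obj C"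
  shows "Zero C b c \<odot> f = Zero C a c"
proof -
  have o: "a \<in> Obj C" "b \<in> Obj C" using Hom_obj f by auto
  interpret G: comm_group "Hom_group C b c" using hom_comm_group c o by simp
  interpret H: comm_group "Hom_group C a c" using hom_comm_group c o by simp
  have z: "Zero C b c \<in> Hom C b c" using zero_hom c o by simp
  have "Zero C b c \<uplus> Zero C b c = Zero C b c"
    using G.l_one[of "Zero C b c"] z unfolding Hom_group_def by simp
  then have "(Zero C b c \<odot> f) \<uplus> (Zero C b c \<odot> f) = Zero C b c \<odot> f"
    using comp_plus[OF f z z] by simp
  then show ?thesis
    using H.l_cancel_one[of "Zero C b c \<odot> f" "Zero C b c \<odot> f"] comp_hom[OF f z]
    unfolding Hom_group_def by simp
qed

text \<open>
Subtract: \<open>f g = f h\<close> means \<open>f (g - h) = 0\<close>.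
\<close>

lemma monic_if_zero_cancel:
  assumes f: "f \<in> Hom C a b"
    and zero: "\<And>w g. \<lbrakk>g \<in> Hom C w a; f \<odot> g = Zero C w b\<rbrakk> \<Longrightarrow> g = Zero C w a"
  shows "monic C f"
  unfolding monic_iff[OF f]
proof (intro allI ballI impI)
  fix w g h assume g: "g \<in> Hom C w a" and h: "h \<in> Hom C w a" and eq: "f \<odot> g = f \<odot> h"
  have o: "w \<in> Obj C" "a \<in> Obj C" "b \<in> Obj C" using Hom_obj f g by auto
  interpret G: comm_group "Hom_group C w a" using hom_comm_group o by simp
  define k where "k = inv\<^bsub>Hom_group C w a\<^esub> h"
  have hk: "k \<in> Hom C w a" "h \<uplus> k = Zero C w a"
    using G.inv_closed[of h] G.r_inv[of h] h unfolding Hom_group_def k_def by auto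
  have "f \<odot> (g \<uplus> k) = f \<odot> (h \<uplus> k)"
    using plus_comp[OF g hk(1) f] plus_comp[OF h hk(1) f] eq by simp
  also have "\<dots> = Zero C w b" using hk(2) comp_zero[OF f o(1)] by simp
  finally have "g \<uplus> k = Zero C w a"
    using zero[of "g \<uplus> k" w] G.m_closed[of g k] g hk(1) unfolding Hom_group_def by simp
  then have "g \<uplus> k = h \<uplus> k" using hk(2) by simp
  then show "g = h" using G.right_cancel[of k g h] g h hk(1) unfolding Hom_group_def by simp
qed

lemma zero_factors:
  assumes j: "j \<in> Hom C b x" and a: "a \<in> Obj C"
  shows "Zero C a x \<preceq> j"
  using comp_factors_self[OF j zero_hom[OF a Hom_obj(1)[OF j]]] comp_zero[OF j a] by simp

lemma zero_object_iff: 
  assumes "a \<in> Obj C"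
  shows "zero_object C a \<longleftrightarrow> Ident C a = Zero C a a"
proof
  assume "zero_object C a"
  then show "Ident C a = Zero C a a"
    using assms ident_hom zero_hom unfolding zero_object_def by blast
next
  assume eq: "Ident C a = Zero C a a"
  have "f = Zero C b a" if "f \<in> Hom C b a" for b f
    using ident_comp[OF that] zero_comp[OF that assms] eq by simp
  moreover have "f = Zero C a b" if "f \<in> Hom C a b" for b f
    using comp_ident[OF that] comp_zero[OF that assms] eq by simp
  ultimately show "zero_object C a"
    using assms zero_hom unfolding zero_object_def by metis
qed

lemma monic_zero_iff:
  assumes m: "m \<in> Hom C a b" "monic C m"
  shows "zero_object C a \<longleftrightarrow> m = Zero C a b"
proof -
  have o: "a \<in> Obj C" "b \<in> Obj C" using Hom_obj m by auto
  have "m = Zero C a b \<longleftrightarrow> m \<odot> Ident C a = m \<odot> Zero C a a"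
    using comp_ident[OF m(1)] comp_zero[OF m(1) o(1)] by simp
  also have "\<dots> \<longleftrightarrow> Ident C a = Zero C a a"
    using monicD[OF m(2,1) ident_hom[OF o(1)] zero_hom[OF o(1) o(1)]] by auto
  finally show ?thesis using zero_object_iff[OF o(1)] by simp
qed

section \<open>Kernels and cokernels\<close>

text \<open>
A kernel of \<open>f\<close> is a monomorphism through which exactly the arrows killed by \<open>f\<close> factor. In this form
kernels are compared by looking at which arrows factor through them.
\<close>

lemma is_kernel_iff:
  assumes f: "f \<in> Hom C a b" and k: "k \<in> Hom C c a"
  shows "is_kernel C f k \<longleftrightarrow>
    monic C k \<and> (\<forall>w. \<forall>g\<in>Hom C w a. f \<odot> g = Zero C w b \<longleftrightarrow> g \<preceq> k)"
proof
  assume "is_kernel C f k"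
  then have zero: "f \<odot> k = Zero C c b"
    and univ: "\<And>w g. g \<in> Hom C w a \<Longrightarrow> f \<odot> g = Zero C w b \<Longrightarrow> \<exists>!u. u \<in> Hom C w c \<and> k \<odot> u = g"
    using HomD[OF f] HomD[OF k] unfolding is_kernel_def by auto
  have kill: "f \<odot> (k \<odot> u) = Zero C w b" if u: "u \<in> Hom C w c" for u w
    using comp_assoc[OF u k f] zero zero_comp[OF u] Hom_obj(2)[OF f] by simp
  have "monic C k"
    unfolding monic_iff[OF k]
  proof (intro allI ballI impI)
    fix w g h assume gh: "g \<in> Hom C w c" "h \<in> Hom C w c" "k \<odot> g = k \<odot> h"
    show "g = h" using univ[OF comp_hom[OF gh(1) k] kill[OF gh(1)]] gh by metis
  qed
  moreover have "f \<odot> g = Zero C w b \<longleftrightarrow> g \<preceq> k" if g: "g \<in> Hom C w a" for w g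
    using univ[OF g] kill unfolding factors_iff[OF g k] by metis
  ultimately show "monic C k \<and> (\<forall>w. \<forall>g\<in>Hom C w a. f \<odot> g = Zero C w b \<longleftrightarrow> g \<preceq> k)" by blast
next
  assume r: "monic C k \<and> (\<forall>w. \<forall>g\<in>Hom C w a. f \<odot> g = Zero C w b \<longleftrightarrow> g \<preceq> k)"
  have "\<exists>!u. u \<in> Hom C w c \<and> k \<odot> u = g" if g: "g \<in> Hom C w a" "f \<odot> g = Zero C w b" for w g
  proof -
    have "g \<preceq> k" using r g by blast
    then obtain u where "u \<in> Hom C w c" "g = k \<odot> u" unfolding factors_iff[OF g(1) k] by blast
    then show ?thesis using monicD[OF _ k] r by metis
  qed
  moreover have "f \<odot> k = Zero C c b" using r k factors_refl by blast
  ultimately show "is_kernel C f k"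
    using HomD[OF f] HomD[OF k] unfolding is_kernel_def by simp
qed

lemma is_cokernel_iff:
  assumes f: "f \<in> Hom C a b" and q: "q \<in> Hom C b c"
  shows "is_cokernel C f q \<longleftrightarrow>
    epic C q \<and> (\<forall>d. \<forall>g\<in>Hom C b d. g \<odot> f = Zero C a d \<longleftrightarrow> (\<exists>u\<in>Hom C c d. g = u \<odot> q))"
proof
  assume "is_cokernel C f q"
  then have zero: "q \<odot> f = Zero C a c"
    and univ: "\<And>w g. g \<in> Hom C b w \<Longrightarrow> g \<odot> f = Zero C a w \<Longrightarrow> \<exists>!u. u \<in> Hom C c w \<and> u \<odot> q = g"
    using HomD[OF f] HomD[OF q] unfolding is_cokernel_def by auto
  have kill: "(u \<odot> q) \<odot> f = Zero C a w" if u: "u \<in> Hom C c w" for u w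
    using comp_assoc[OF f q u] zero comp_zero[OF u] Hom_obj(1)[OF f] by simp
  have "epic C q"
    unfolding epic_iff[OF q]
  proof (intro allI ballI impI)
    fix w g h assume gh: "g \<in> Hom C c w" "h \<in> Hom C c w" "g \<odot> q = h \<odot> q"
    show "g = h" using univ[OF comp_hom[OF q gh(1)] kill[OF gh(1)]] gh by metis
  qed
  moreover have "g \<odot> f = Zero C a w \<longleftrightarrow> (\<exists>u\<in>Hom C c w. g = u \<odot> q)" if g: "g \<in> Hom C b w" for w g
    using univ[OF g] kill by metis
  ultimately show "epic C q \<and> (\<forall>d. \<forall>g\<in>Hom C b d. g \<odot> f = Zero C a d \<longleftrightarrow> (\<exists>u\<in>Hom C c d. g = u \<odot> q))"
    by blast
next
  assume r: "epic C q \<and> (\<forall>d. \<forall>g\<in>Hom C b d. g \<odot> f = Zero C a d \<longleftrightarrow> (\<exists>u\<in>Hom C c d. g = u \<odot> q))"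
  have "\<exists>!u. u \<in> Hom C c w \<and> u \<odot> q = g" if g: "g \<in> Hom C b w" "g \<odot> f = Zero C a w" for w g
  proof -
    obtain u where "u \<in> Hom C c w" "g = u \<odot> q" using r g by blast
    then show ?thesis using epicD[OF _ q] r by metis
  qed
  moreover have "q \<odot> f = Zero C a c"
    using r q ident_comp[OF q] ident_hom Hom_obj(2)[OF q] by metis
  ultimately show "is_cokernel C f q"
    using HomD[OF f] HomD[OF q] unfolding is_cokernel_def by simp
qed

end

context abelian_category
begin

lemma obtain_kernel:
  assumes f: "f \<in> Hom C a b"
  obtains c k where "k \<in> Hom C c a" "monic C k" "is_kernel C f k"
    "\<And>w g. g \<in> Hom C w a \<Longrightarrow> f \<odot> g = Zero C w b \<longleftrightarrow> g \<preceq> k"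
proof -
  obtain k where k: "is_kernel C f k" using ex_kernel HomD(1)[OF f] by blast
  then have kh: "k \<in> Hom C (Dom C k) a" using HomD[OF f] unfolding is_kernel_def Hom_def by simp
  show thesis using that[OF kh _ k] k unfolding is_kernel_iff[OF f kh] by blast
qed

lemma obtain_cokernel:
  assumes f: "f \<in> Hom C a b"
  obtains c q where "q \<in> Hom C b c" "epic C q" "is_cokernel C f q"
    "\<And>d g. g \<in> Hom C b d \<Longrightarrow> g \<odot> f = Zero C a d \<longleftrightarrow> (\<exists>u\<in>Hom C c d. g = u \<odot> q)"
proof -
  obtain q where q: "is_cokernel C f q" using ex_cokernel HomD(1)[OF f] by blast
  then have qh: "q \<in> Hom C b (Cod C q)" using HomD[OF f] unfolding is_cokernel_def Hom_def by simp
  show thesis using that[OF qh _ q] q unfolding is_cokernel_iff[OF f qh] by blast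
qed

text \<open>
Any monomorphism \<open>k\<close> is the kernel of some \<open>f\<close>, and \<open>f\<close> factors through the cokernel \<open>q\<close> of \<open>k\<close>, so that
\<open>q\<close> kills no more than \<open>f\<close> does.
\<close>

lemma kernel_of_cokernel:
  assumes k: "k \<in> Hom C a b" "monic C k" and q: "q \<in> Hom C b c" "is_cokernel C k q"
  shows "is_kernel C q k"
  unfolding is_kernel_iff[OF q(1) k(1)]
proof (intro conjI allI ballI)
  fix w g assume g: "g \<in> Hom C w b"
  obtain f where fk: "is_kernel C f k" using monic_is_kernel k by blast
  then have f: "f \<in> Hom C b (Cod C f)" using HomD[OF k(1)] unfolding is_kernel_def Hom_def by simp
  have o: "a \<in> Obj C" "c \<in> Obj C" "w \<in> Obj C" using Hom_obj k q g by auto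
  have "f \<odot> k = Zero C a (Cod C f)" using fk k(1) factors_refl unfolding is_kernel_iff[OF f k(1)] by blast
  then obtain u where u: "u \<in> Hom C c (Cod C f)" "f = u \<odot> q"
    using q f unfolding is_cokernel_iff[OF k(1) q(1)] by blast
  have qk: "q \<odot> k = Zero C a c"
    using q ident_comp[OF q(1)] ident_hom[OF o(2)] unfolding is_cokernel_iff[OF k(1) q(1)] by metis
  show "q \<odot> g = Zero C w c \<longleftrightarrow> g \<preceq> k"
  proof
    assume "q \<odot> g = Zero C w c"
    then have "f \<odot> g = Zero C w (Cod C f)"
      using comp_assoc[OF g q(1) u(1)] comp_zero[OF u(1) o(3)] u(2) by simp
    then show "g \<preceq> k" using fk g unfolding is_kernel_iff[OF f k(1)] by blast
  next
    assume "g \<preceq> k"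
    then obtain h where "h \<in> Hom C w a" "g = k \<odot> h" unfolding factors_iff[OF g k(1)] by blast
    then show "q \<odot> g = Zero C w c" using comp_assoc[OF _ k(1) q(1)] qk zero_comp o(2) by metis
  qed
qed (rule k(2))

lemma cokernel_of_kernel:
  assumes q: "q \<in> Hom C b c" "epic C q" and k: "k \<in> Hom C a b" "is_kernel C q k"
  shows "is_cokernel C k q"
  unfolding is_cokernel_iff[OF k(1) q(1)]
proof (intro conjI allI ballI)
  fix w g assume g: "g \<in> Hom C b w"
  obtain f where fq: "is_cokernel C f q" using epic_is_cokernel q by blast
  then have f: "f \<in> Hom C (Dom C f) b" using HomD[OF q(1)] unfolding is_cokernel_def Hom_def by simp
  have o: "a \<in> Obj C" "c \<in> Obj C" "w \<in> Obj C" "Dom C f \<in> Obj C" using Hom_obj k q g f by auto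
  have "q \<odot> f = Zero C (Dom C f) c"
    using fq q(1) ident_comp[OF q(1)] ident_hom[OF o(2)] unfolding is_cokernel_iff[OF f q(1)] by metis
  then have "f \<preceq> k" using k f unfolding is_kernel_iff[OF q(1) k(1)] by blast
  then obtain h where h: "h \<in> Hom C (Dom C f) a" "f = k \<odot> h" unfolding factors_iff[OF f k(1)] by blast
  have qk: "q \<odot> k = Zero C a c"
    using k factors_refl[OF k(1)] unfolding is_kernel_iff[OF q(1) k(1)] by blast
  show "g \<odot> k = Zero C a w \<longleftrightarrow> (\<exists>u\<in>Hom C c w. g = u \<odot> q)"
  proof
    assume "g \<odot> k = Zero C a w"
    then have "g \<odot> f = Zero C (Dom C f) w"
      using comp_assoc[OF h(1) k(1) g] zero_comp[OF h(1) o(3)] h(2) by simp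
    then show "\<exists>u\<in>Hom C c w. g = u \<odot> q" using fq g unfolding is_cokernel_iff[OF f q(1)] by blast
  next
    assume "\<exists>u\<in>Hom C c w. g = u \<odot> q"
    then show "g \<odot> k = Zero C a w" using comp_assoc[OF k(1) q(1)] qk comp_zero o(1) by metis
  qed
qed (rule q(2))

lemma monic_is_kernel_of_epic:
  assumes n: "n \<in> Hom C a b" "monic C n"
  obtains c q where "q \<in> Hom C b c" "epic C q" "is_cokernel C n q"
    "\<And>w g. g \<in> Hom C w b \<Longrightarrow> q \<odot> g = Zero C w c \<longleftrightarrow> g \<preceq> n"
proof -
  obtain c q where q: "q \<in> Hom C b c" "epic C q" "is_cokernel C n q" using obtain_cokernel[OF n(1)] by metis
  show thesis
    using that[OF q] kernel_of_cokernel[OF n q(1,3)] unfolding is_kernel_iff[OF q(1) n(1)] by blast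
qed

text \<open>
Take for \<open>e\<close> the cokernel of the kernel \<open>k\<close> of \<open>f\<close>. For \<open>m\<close> to be monic it suffices that \<open>m g = 0\<close> implies
\<open>g = 0\<close>. Let \<open>p\<close> be a cokernel of such a \<open>g\<close>; then \<open>f\<close> factors through \<open>p e\<close>, hence the kernel of the
epimorphism \<open>p e\<close> lies in \<open>k\<close> and is killed by \<open>e\<close>. So \<open>e\<close> factors through \<open>p e\<close>, which makes \<open>p\<close> split
monic, and \<open>p g = 0\<close> gives \<open>g = 0\<close>.
\<close>

lemma epi_mono_factorization:
  assumes f: "f \<in> Hom C a b"
  obtains c e m where "e \<in> Hom C a c" "epic C e" "m \<in> Hom C c b" "monic C m" "f = m \<odot> e"
proof -
  obtain d k where k: "k \<in> Hom C d a"
      and ker: "\<And>w g. g \<in> Hom C w a \<Longrightarrow> f \<odot> g = Zero C w b \<longleftrightarrow> g \<preceq> k"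
    using obtain_kernel[OF f] by metis
  obtain c e where e: "e \<in> Hom C a c" "epic C e"
      and coker: "\<And>w g. g \<in> Hom C a w \<Longrightarrow> g \<odot> k = Zero C d w \<longleftrightarrow> (\<exists>u\<in>Hom C c w. g = u \<odot> e)"
    using obtain_cokernel[OF k] by metis
  have "f \<odot> k = Zero C d b" using ker[OF k] factors_refl[OF k] by blast
  then obtain m where m: "m \<in> Hom C c b" "f = m \<odot> e" using coker[OF f] by blast
  have o: "a \<in> Obj C" "b \<in> Obj C" "c \<in> Obj C" "d \<in> Obj C" using Hom_obj f e k by auto
  have ek: "e \<odot> k = Zero C d c" using coker[OF e(1)] ident_comp[OF e(1)] ident_hom[OF o(3)] by metis
  have "g = Zero C w c" if g: "g \<in> Hom C w c" "m \<odot> g = Zero C w b" for w g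
  proof -
    obtain v p where p: "p \<in> Hom C c v" "epic C p"
        and cop: "\<And>x h. h \<in> Hom C c x \<Longrightarrow> h \<odot> g = Zero C w x \<longleftrightarrow> (\<exists>u\<in>Hom C v x. h = u \<odot> p)"
      using obtain_cokernel[OF g(1)] by metis
    have wv: "w \<in> Obj C" "v \<in> Obj C" using Hom_obj g p by auto
    obtain m' where m': "m' \<in> Hom C v b" "m = m' \<odot> p" using cop[OF m(1)] g(2) by blast
    have pe: "p \<odot> e \<in> Hom C a v" "epic C (p \<odot> e)" using comp_hom e p epic_comp by auto
    obtain x l where l: "l \<in> Hom C x a" "is_kernel C (p \<odot> e) l" using obtain_kernel[OF pe(1)] by metis
    have cl: "is_cokernel C l (p \<odot> e)" using cokernel_of_kernel[OF pe l] .
    have xo: "x \<in> Obj C" using Hom_obj l by auto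
    have "(p \<odot> e) \<odot> l = Zero C x v"
      using l factors_refl[OF l(1)] unfolding is_kernel_iff[OF pe(1) l(1)] by blast
    moreover have "f = m' \<odot> (p \<odot> e)" using m m' comp_assoc[OF e(1) p(1) m'(1)] by simp
    ultimately have "f \<odot> l = Zero C x b"
      using comp_assoc[OF l(1) pe(1) m'(1)] comp_zero[OF m'(1) xo] by simp
    then have "l \<preceq> k" using ker[OF l(1)] by blast
    then obtain l' where l': "l' \<in> Hom C x d" "l = k \<odot> l'" unfolding factors_iff[OF l(1) k] by blast
    then have "e \<odot> l = Zero C x c" using comp_assoc[OF l'(1) k e(1)] ek zero_comp[OF l'(1) o(3)] by simp
    then obtain r where r: "r \<in> Hom C v c" "e = r \<odot> (p \<odot> e)"
      using cl e(1) unfolding is_cokernel_iff[OF l(1) pe(1)] by blast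
    have "(r \<odot> p) \<odot> e = Ident C c \<odot> e"
      using r comp_assoc[OF e(1) p(1) r(1)] ident_comp[OF e(1)] by simp
    then have rp: "r \<odot> p = Ident C c"
      by (rule epicD[OF e(2,1) comp_hom[OF p(1) r(1)] ident_hom[OF o(3)]])
    have "p \<odot> g = Zero C w v" using cop[OF p(1)] ident_comp[OF p(1)] ident_hom[OF wv(2)] by metis
    then have "(r \<odot> p) \<odot> g = Zero C w c" using comp_assoc[OF g(1) p(1) r(1)] comp_zero[OF r(1) wv(1)] by simp
    then show ?thesis using rp ident_comp[OF g(1)] by simp
  qed
  then have "monic C m" by (rule monic_if_zero_cancel[OF m(1)])
  then show thesis using that e m by blast
qed

section \<open>Preimages and the correspondence theorem\<close>

text \<open>
\<open>t\<close> is the pullback of \<open>n\<close> along \<open>g\<close>, described by the arrows that factor through it.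
\<close>

definition is_preimage :: "'b \<Rightarrow> 'b \<Rightarrow> 'b \<Rightarrow> bool" where
  "is_preimage g n t \<longleftrightarrow> monic C t \<and> (\<forall>w. \<forall>h\<in>Hom C w (Cod C t). h \<preceq> t \<longleftrightarrow> g \<odot> h \<preceq> n)"

lemma is_preimage_iff:
  assumes "t \<in> Hom C d a"
  shows "is_preimage g n t \<longleftrightarrow> monic C t \<and> (\<forall>w. \<forall>h\<in>Hom C w a. h \<preceq> t \<longleftrightarrow> g \<odot> h \<preceq> n)"
  using HomD[OF assms] unfolding is_preimage_def by simp

lemma kernel_is_preimage:
  assumes g: "g \<in> Hom C a b" and q: "q \<in> Hom C b c" and t: "t \<in> Hom C d a"
    and n: "\<And>w h. h \<in> Hom C w b \<Longrightarrow> q \<odot> h = Zero C w c \<longleftrightarrow> h \<preceq> n"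
  shows "is_preimage g n t \<longleftrightarrow> is_kernel C (q \<odot> g) t"
  unfolding is_preimage_iff[OF t] is_kernel_iff[OF comp_hom[OF g q] t]
  using n comp_assoc[OF _ g q] comp_hom[OF _ g] by metis

lemma ex_preimage:
  assumes g: "g \<in> Hom C a b" and n: "n \<in> Hom C c b" "monic C n"
  obtains d t where "t \<in> Hom C d a" "is_preimage g n t"
proof -
  obtain z q where q: "q \<in> Hom C b z" "\<And>w g. g \<in> Hom C w b \<Longrightarrow> q \<odot> g = Zero C w z \<longleftrightarrow> g \<preceq> n"
    using monic_is_kernel_of_epic[OF n] by metis
  obtain d t where t: "t \<in> Hom C d a" "is_kernel C (q \<odot> g) t"
    using obtain_kernel[OF comp_hom[OF g q(1)]] by metis
  then show thesis using that kernel_is_preimage[OF g q(1) t(1) q(2)] by blast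
qed

text \<open>
Let \<open>q\<close> and \<open>q'\<close> be cokernels of \<open>n\<close> and \<open>n'\<close>. The preimages are the kernels of \<open>q g\<close> and \<open>q' g\<close>. Since \<open>q g\<close>
is epic, it is a cokernel of its kernel \<open>t\<close>; if \<open>t\<close> is contained in \<open>t'\<close>, then \<open>q' g\<close> factors through
\<open>q g\<close>, hence \<open>q'\<close> through \<open>q\<close>.
\<close>

lemma preimage_le_iff:
  assumes g: "g \<in> Hom C a b" "epic C g"
    and n: "n \<in> Hom C c b" "monic C n" and n': "n' \<in> Hom C c' b" "monic C n'"
    and t: "t \<in> Hom C d a" "is_preimage g n t" and t': "t' \<in> Hom C d' a" "is_preimage g n' t'"
  shows "t \<preceq> t' \<longleftrightarrow> n \<preceq> n'"
proof
  assume le: "t \<preceq> t'"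
  obtain z q where q: "q \<in> Hom C b z" "epic C q"
      "\<And>w g. g \<in> Hom C w b \<Longrightarrow> q \<odot> g = Zero C w z \<longleftrightarrow> g \<preceq> n"
    using monic_is_kernel_of_epic[OF n] by metis
  obtain z' q' where q': "q' \<in> Hom C b z'"
      "\<And>w g. g \<in> Hom C w b \<Longrightarrow> q' \<odot> g = Zero C w z' \<longleftrightarrow> g \<preceq> n'"
    using monic_is_kernel_of_epic[OF n'] by metis
  have qg: "q \<odot> g \<in> Hom C a z" "epic C (q \<odot> g)" using comp_hom epic_comp g q by auto
  have "is_kernel C (q \<odot> g) t" using kernel_is_preimage[OF g(1) q(1) t(1) q(3)] t(2) by blast
  then have cok: "is_cokernel C t (q \<odot> g)" using cokernel_of_kernel[OF qg t(1)] by blast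
  have "g \<odot> t \<preceq> n'" using le t(1) t'(2) unfolding is_preimage_iff[OF t'(1)] by blast
  then have "q' \<odot> (g \<odot> t) = Zero C d z'" using q'(2)[OF comp_hom[OF t(1) g(1)]] by blast
  then have "(q' \<odot> g) \<odot> t = Zero C d z'" using comp_assoc[OF t(1) g(1) q'(1)] by simp
  then obtain u where u: "u \<in> Hom C z z'" "q' \<odot> g = u \<odot> (q \<odot> g)"
    using cok comp_hom[OF g(1) q'(1)] unfolding is_cokernel_iff[OF t(1) qg(1)] by blast
  then have "q' \<odot> g = (u \<odot> q) \<odot> g" using comp_assoc[OF g(1) q(1) u(1)] by simp
  then have "q' = u \<odot> q" by (rule epicD[OF g(2,1) q'(1) comp_hom[OF q(1) u(1)]])
  moreover have "q \<odot> n = Zero C c z" using q(3)[OF n(1)] factors_refl[OF n(1)] by blast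
  ultimately have "q' \<odot> n = Zero C c z'"
    using comp_assoc[OF n(1) q(1) u(1)] comp_zero[OF u(1) Hom_obj(1)[OF n(1)]] by simp
  then show "n \<preceq> n'" using q'(2)[OF n(1)] by blast
next
  assume le: "n \<preceq> n'"
  have "g \<odot> t \<preceq> n" using t factors_refl[OF t(1)] unfolding is_preimage_iff[OF t(1)] by blast
  then have "g \<odot> t \<preceq> n'" using factors_trans[OF _ le comp_hom[OF t(1) g(1)] n(1) n'(1)] by blast
  then show "t \<preceq> t'" using t(1) t'(2) unfolding is_preimage_iff[OF t'(1)] by blast
qed

text \<open>
The cokernel of \<open>t\<close> kills the kernel of \<open>g\<close>, so it factors through \<open>g\<close>; the kernel of the resulting
arrow out of \<open>b\<close> has the preimage \<open>t\<close>.
\<close>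

lemma obtain_image_of_preimage:
  assumes g: "g \<in> Hom C a b" "epic C g" and t: "t \<in> Hom C d a" "monic C t"
    and ker: "\<And>w h. h \<in> Hom C w a \<Longrightarrow> g \<odot> h = Zero C w b \<Longrightarrow> h \<preceq> t"
  obtains c n where "n \<in> Hom C c b" "monic C n" "is_preimage g n t"
proof -
  obtain z s where s: "s \<in> Hom C a z" "is_cokernel C t s"
    using monic_is_kernel_of_epic[OF t] by metis
  have st: "is_kernel C s t" using kernel_of_cokernel[OF t s] .
  obtain y k where k: "k \<in> Hom C y a" "is_kernel C g k"
      "\<And>w h. h \<in> Hom C w a \<Longrightarrow> g \<odot> h = Zero C w b \<longleftrightarrow> h \<preceq> k"
    using obtain_kernel[OF g(1)] by metis
  have cg: "is_cokernel C k g" using cokernel_of_kernel[OF g k(1,2)] .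
  have "k \<preceq> t" using ker[OF k(1)] k(3)[OF k(1)] factors_refl[OF k(1)] by blast
  then have "s \<odot> k = Zero C y z" using st k(1) unfolding is_kernel_iff[OF s(1) t(1)] by blast
  then obtain s' where s': "s' \<in> Hom C b z" "s = s' \<odot> g"
    using cg s(1) unfolding is_cokernel_iff[OF k(1) g(1)] by blast
  obtain c n where n: "n \<in> Hom C c b" "monic C n"
      "\<And>w h. h \<in> Hom C w b \<Longrightarrow> s' \<odot> h = Zero C w z \<longleftrightarrow> h \<preceq> n"
    using obtain_kernel[OF s'(1)] by metis
  have "is_preimage g n t" using kernel_is_preimage[OF g(1) s'(1) t(1) n(3)] st s'(2) by blast
  then show thesis using that n by blast
qed

end

section \<open>Subquotients and the diamond isomorphism\<close>

context category
begin

lemma isomorphic_sym: "isomorphic C a b \<Longrightarrow> isomorphic C b a"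
  unfolding isomorphic_def by blast

lemma isomorphic_trans:
  assumes "isomorphic C a b" "isomorphic C b c"
  shows "isomorphic C a c"
proof -
  obtain f g where f: "f \<in> Hom C a b" and g: "g \<in> Hom C b a"
    and fg: "g \<odot> f = Ident C a" "f \<odot> g = Ident C b"
    using assms(1) unfolding isomorphic_def by blast
  obtain h k where h: "h \<in> Hom C b c" and k: "k \<in> Hom C c b"
    and hk: "k \<odot> h = Ident C b" "h \<odot> k = Ident C c"
    using assms(2) unfolding isomorphic_def by blast
  have "(g \<odot> k) \<odot> (h \<odot> f) = g \<odot> ((k \<odot> h) \<odot> f)"
    using comp_assoc[OF comp_hom[OF f h] k g] comp_assoc[OF f h k] by simp
  also have "\<dots> = Ident C a" using hk fg ident_comp[OF f] by simp
  finally have 1: "(g \<odot> k) \<odot> (h \<odot> f) = Ident C a" .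
  have "(h \<odot> f) \<odot> (g \<odot> k) = h \<odot> ((f \<odot> g) \<odot> k)"
    using comp_assoc[OF comp_hom[OF k g] f h] comp_assoc[OF k g f] by simp
  also have "\<dots> = Ident C c" using hk fg ident_comp[OF k] by simp
  finally have 2: "(h \<odot> f) \<odot> (g \<odot> k) = Ident C c" .
  show ?thesis unfolding isomorphic_def
    using 1 2 comp_hom[OF f h] comp_hom[OF k g] Hom_obj[OF f] Hom_obj[OF h] by blast
qed

end

context abelian_category
begin

text \<open>
\<open>Z\<close> is a version of \<open>t/(t \<inter> j)\<close>: an epimorphic image of the domain of \<open>t\<close> in which exactly the part of
\<open>t\<close> lying in \<open>j\<close> becomes zero. Intersecting with \<open>j\<close> inside the definition allows both \<open>P/(P \<inter> Q)\<close> and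
\<open>(P + Q)/Q\<close> to be described with the monomorphism of \<open>Q\<close> as \<open>j\<close>.
\<close>

definition subquotient :: "'b \<Rightarrow> 'b \<Rightarrow> 'a \<Rightarrow> bool" where
  "subquotient t j Z \<longleftrightarrow> (\<exists>e\<in>Hom C (Dom C t) Z. epic C e \<and>
     (\<forall>w. \<forall>h\<in>Hom C w (Dom C t). e \<odot> h = Zero C w Z \<longleftrightarrow> t \<odot> h \<preceq> j))"

lemma subquotientI:
  assumes "t \<in> Hom C d X" "e \<in> Hom C d Z" "epic C e"
    and "\<And>w h. h \<in> Hom C w d \<Longrightarrow> e \<odot> h = Zero C w Z \<longleftrightarrow> t \<odot> h \<preceq> j"
  shows "subquotient t j Z"
  using assms HomD[OF assms(1)] unfolding subquotient_def by blast

lemma subquotientE: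
  assumes "subquotient t j Z" "t \<in> Hom C d X"
  obtains e where "e \<in> Hom C d Z" "epic C e"
    "\<And>w h. h \<in> Hom C w d \<Longrightarrow> e \<odot> h = Zero C w Z \<longleftrightarrow> t \<odot> h \<preceq> j"
  using assms HomD[OF assms(2)] unfolding subquotient_def by blast

lemma subquotient_cong:
  assumes t: "t \<in> Hom C d X" "monic C t" and t': "t' \<in> Hom C d' X" "monic C t'"
    and tt': "t \<preceq> t'" "t' \<preceq> t"
    and jj': "\<And>w h. \<lbrakk>h \<in> Hom C w X; h \<preceq> t\<rbrakk> \<Longrightarrow> h \<preceq> j \<longleftrightarrow> h \<preceq> j'"
    and sq: "subquotient t j Z"
  shows "subquotient t' j' Z"
proof -
  obtain e where e: "e \<in> Hom C d Z" "epic C e"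
      "\<And>w h. h \<in> Hom C w d \<Longrightarrow> e \<odot> h = Zero C w Z \<longleftrightarrow> t \<odot> h \<preceq> j"
    using subquotientE[OF sq t(1)] by metis
  obtain b where b: "b \<in> Hom C d d'" "t = t' \<odot> b" using tt'(1) factors_iff[OF t(1) t'(1)] by blast
  obtain g where g: "g \<in> Hom C d' d" "t' = t \<odot> g" using tt'(2) factors_iff[OF t'(1) t(1)] by blast
  have "t \<odot> (g \<odot> b) = t \<odot> Ident C d"
    using comp_assoc[OF b(1) g(1) t(1)] b(2)[symmetric] g(2)[symmetric] comp_ident[OF t(1)] by simp
  then have "g \<odot> b = Ident C d"
    by (rule monicD[OF t(2,1) comp_hom[OF b(1) g(1)] ident_hom[OF Hom_obj(1)[OF t(1)]]])
  then have "epic C g"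
    using epic_cancel[OF b(1) g(1)] ident_epic[OF Hom_obj(1)[OF t(1)]] by simp
  then have "epic C (e \<odot> g)" using epic_comp[OF g(1) _ e(1,2)] by blast
  then show ?thesis
  proof (rule subquotientI[OF t'(1) comp_hom[OF g(1) e(1)]])
    fix w h assume h: "h \<in> Hom C w d'"
    have gh: "g \<odot> h \<in> Hom C w d" using comp_hom[OF h g(1)] .
    have "(e \<odot> g) \<odot> h = Zero C w Z \<longleftrightarrow> t \<odot> (g \<odot> h) \<preceq> j"
      using e(3)[OF gh] comp_assoc[OF h g(1) e(1)] by simp
    also have "\<dots> \<longleftrightarrow> t \<odot> (g \<odot> h) \<preceq> j'"
      using jj'[OF comp_hom[OF gh t(1)] comp_factors_self[OF t(1) gh]] .
    also have "t \<odot> (g \<odot> h) = t' \<odot> h" using comp_assoc[OF h g(1) t(1)] g(2) by simp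
    finally show "(e \<odot> g) \<odot> h = Zero C w Z \<longleftrightarrow> t' \<odot> h \<preceq> j'" .
  qed
qed

lemma cokernels_isomorphic:
  assumes f: "f \<in> Hom C a b" and q: "q \<in> Hom C b c" "is_cokernel C f q"
    and q': "q' \<in> Hom C b c'" "is_cokernel C f q'"
  shows "isomorphic C c c'"
proof -
  have o: "c \<in> Obj C" "c' \<in> Obj C" using Hom_obj q q' by auto
  have cq: "epic C q" "\<And>d g. g \<in> Hom C b d \<Longrightarrow> g \<odot> f = Zero C a d \<longleftrightarrow> (\<exists>u\<in>Hom C c d. g = u \<odot> q)"
    using q(2) unfolding is_cokernel_iff[OF f q(1)] by blast+
  have cq': "epic C q'" "\<And>d g. g \<in> Hom C b d \<Longrightarrow> g \<odot> f = Zero C a d \<longleftrightarrow> (\<exists>u\<in>Hom C c' d. g = u \<odot> q')"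
    using q'(2) unfolding is_cokernel_iff[OF f q'(1)] by blast+
  have qf: "q \<odot> f = Zero C a c" using cq(2)[OF q(1)] ident_comp[OF q(1)] ident_hom[OF o(1)] by metis
  have qf': "q' \<odot> f = Zero C a c'" using cq'(2)[OF q'(1)] ident_comp[OF q'(1)] ident_hom[OF o(2)] by metis
  obtain u where u: "u \<in> Hom C c' c" "q = u \<odot> q'" using cq'(2)[OF q(1)] qf by blast
  obtain v where v: "v \<in> Hom C c c'" "q' = v \<odot> q" using cq(2)[OF q'(1)] qf' by blast
  have "(u \<odot> v) \<odot> q = Ident C c \<odot> q"
    using comp_assoc[OF q(1) v(1) u(1)] u(2)[symmetric] v(2)[symmetric] ident_comp[OF q(1)] by simp
  then have uv: "u \<odot> v = Ident C c"
    by (rule epicD[OF cq(1) q(1) comp_hom[OF v(1) u(1)] ident_hom[OF o(1)]])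
  have "(v \<odot> u) \<odot> q' = Ident C c' \<odot> q'"
    using comp_assoc[OF q'(1) u(1) v(1)] u(2)[symmetric] v(2)[symmetric] ident_comp[OF q'(1)] by simp
  then have vu: "v \<odot> u = Ident C c'"
    by (rule epicD[OF cq'(1) q'(1) comp_hom[OF u(1) v(1)] ident_hom[OF o(2)]])
  show ?thesis unfolding isomorphic_def using o u v uv vu by blast
qed

lemma subquotient_unique:
  assumes t: "t \<in> Hom C d X" and "subquotient t j Z" "subquotient t j Z'"
  shows "isomorphic C Z Z'"
proof -
  obtain e where e: "e \<in> Hom C d Z" "epic C e"
      "\<And>w h. h \<in> Hom C w d \<Longrightarrow> e \<odot> h = Zero C w Z \<longleftrightarrow> t \<odot> h \<preceq> j"
    using subquotientE[OF assms(2) t] by metis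
  obtain e' where e': "e' \<in> Hom C d Z'" "epic C e'"
      "\<And>w h. h \<in> Hom C w d \<Longrightarrow> e' \<odot> h = Zero C w Z' \<longleftrightarrow> t \<odot> h \<preceq> j"
    using subquotientE[OF assms(3) t] by metis
  obtain c k where k: "k \<in> Hom C c d" "is_kernel C e k"
    using obtain_kernel[OF e(1)] by metis
  have "is_kernel C e' k"
    using k(2) e(3) e'(3) unfolding is_kernel_iff[OF e(1) k(1)] is_kernel_iff[OF e'(1) k(1)] by blast
  then show ?thesis
    using cokernels_isomorphic[OF k(1) e(1) _ e'(1)] cokernel_of_kernel e e' k by blast
qed

lemma subquotient_iff_cokernel:
  assumes i: "i \<in> Hom C p X" "monic C i" and j: "j \<in> Hom C r X" "monic C j"
    and h: "h \<in> Hom C p r" "i = j \<odot> h"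
  shows "subquotient j i Z \<longleftrightarrow> (\<exists>q\<in>Hom C r Z. is_cokernel C h q)"
proof -
  have hm: "monic C h" using monic_cancel[OF h(1) j(1)] i(2) h(2) by simp
  have "is_cokernel C h q \<longleftrightarrow>
      epic C q \<and> (\<forall>w. \<forall>g\<in>Hom C w r. q \<odot> g = Zero C w Z \<longleftrightarrow> j \<odot> g \<preceq> i)" if q: "q \<in> Hom C r Z" for q
  proof -
    have "is_cokernel C h q \<longleftrightarrow> epic C q \<and> is_kernel C q h"
      using kernel_of_cokernel[OF h(1) hm q] cokernel_of_kernel[OF q _ h(1)]
        is_cokernel_iff[OF h(1) q] by blast
    also have "\<dots> \<longleftrightarrow> epic C q \<and> (\<forall>w. \<forall>g\<in>Hom C w r. q \<odot> g = Zero C w Z \<longleftrightarrow> g \<preceq> h)"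
      using is_kernel_iff[OF q h(1)] hm by blast
    also have "\<dots> \<longleftrightarrow> epic C q \<and> (\<forall>w. \<forall>g\<in>Hom C w r. q \<odot> g = Zero C w Z \<longleftrightarrow> j \<odot> g \<preceq> i)"
      using monic_comp_factors_iff[OF _ h(1) j] h(2) by simp
    finally show ?thesis .
  qed
  then show ?thesis using HomD[OF j(1)] unfolding subquotient_def by blast
qed

lemma obtain_meet:
  assumes i: "i \<in> Hom C p X" "monic C i" and j: "j \<in> Hom C r X" "monic C j"
  obtains d m where "m \<in> Hom C d X" "monic C m"
    "\<And>w h. h \<in> Hom C w X \<Longrightarrow> h \<preceq> m \<longleftrightarrow> h \<preceq> i \<and> h \<preceq> j"
proof -
  obtain d k where k: "k \<in> Hom C d p" "is_preimage i j k" using ex_preimage[OF i(1) j] by metis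
  have pre: "\<And>w h. h \<in> Hom C w p \<Longrightarrow> h \<preceq> k \<longleftrightarrow> i \<odot> h \<preceq> j" and km: "monic C k"
    using k(2) unfolding is_preimage_iff[OF k(1)] by blast+
  have m: "i \<odot> k \<in> Hom C d X" "monic C (i \<odot> k)" using comp_hom[OF k(1) i(1)] monic_comp[OF k(1) km i] .
  have "h \<preceq> i \<odot> k \<longleftrightarrow> h \<preceq> i \<and> h \<preceq> j" if h: "h \<in> Hom C w X" for w h
  proof
    assume le: "h \<preceq> i \<odot> k"
    have "i \<odot> k \<preceq> j" using pre[OF k(1)] factors_refl[OF k(1)] by blast
    then show "h \<preceq> i \<and> h \<preceq> j"
      using factors_trans[OF le _ h m(1)] comp_factors_self[OF i(1) k(1)] i(1) j(1) by blast
  next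
    assume le: "h \<preceq> i \<and> h \<preceq> j"
    then obtain g where g: "g \<in> Hom C w p" "h = i \<odot> g" using factors_iff[OF h i(1)] by blast
    then have "g \<preceq> k" using le pre by blast
    then show "h \<preceq> i \<odot> k" using factors_comp_left[OF _ g(1) k(1) i(1)] g(2) by blast
  qed
  then show thesis using that m by blast
qed

text \<open>
Let \<open>q : X \<rightarrow> X/Q\<close> be the cokernel of \<open>j\<close> and \<open>q i = n e\<close> with \<open>n : N \<rightarrow> X/Q\<close> monic and \<open>e\<close> epic. The
preimage \<open>t\<close> of \<open>n\<close> along \<open>q\<close> is the join: a subobject above \<open>j\<close> is the preimage of some \<open>v\<close>, and it
contains \<open>i\<close> exactly if \<open>q i\<close>, equivalently \<open>n\<close>, factors through \<open>v\<close>. By construction \<open>e\<close> exhibits \<open>N\<close> as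
\<open>P/(P \<inter> Q)\<close>.

The last conclusion is the modular law in disguise: subobjects between \<open>j\<close> and \<open>t\<close> correspond to
subobjects of \<open>N\<close> along \<open>q\<close>, and these are recovered from their preimages along the epimorphism \<open>e\<close>,
which are the intersections with \<open>P\<close>.
\<close>

lemma diamond:
  assumes i: "i \<in> Hom C p X" "monic C i" and j: "j \<in> Hom C r X" "monic C j"
  obtains d t N where "t \<in> Hom C d X" "monic C t" "i \<preceq> t" "j \<preceq> t"
    "\<And>s u. \<lbrakk>u \<in> Hom C s X; monic C u; i \<preceq> u; j \<preceq> u\<rbrakk> \<Longrightarrow> t \<preceq> u"
    "subquotient i j N" "subquotient t j N"
    "\<And>s x s' y. \<lbrakk>x \<in> Hom C s X; monic C x; j \<preceq> x; x \<preceq> t; y \<in> Hom C s' X; monic C y; j \<preceq> y; y \<preceq> t;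
       \<And>w h. h \<in> Hom C w p \<Longrightarrow> i \<odot> h \<preceq> x \<Longrightarrow> i \<odot> h \<preceq> y\<rbrakk> \<Longrightarrow> x \<preceq> y"
proof -
  obtain Y q where q: "q \<in> Hom C X Y" "epic C q"
      "\<And>w g. g \<in> Hom C w X \<Longrightarrow> q \<odot> g = Zero C w Y \<longleftrightarrow> g \<preceq> j"
    using monic_is_kernel_of_epic[OF j] by metis
  obtain N e n where e: "e \<in> Hom C p N" "epic C e" and n: "n \<in> Hom C N Y" "monic C n"
      and qi: "q \<odot> i = n \<odot> e"
    using epi_mono_factorization[OF comp_hom[OF i(1) q(1)]] by metis
  obtain d t where t: "t \<in> Hom C d X" "is_preimage q n t" using ex_preimage[OF q(1) n] by metis
  have tm: "monic C t" and pre: "\<And>w h. h \<in> Hom C w X \<Longrightarrow> h \<preceq> t \<longleftrightarrow> q \<odot> h \<preceq> n"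
    using t(2) unfolding is_preimage_iff[OF t(1)] by blast+
  have o: "r \<in> Obj C" "N \<in> Obj C" "Y \<in> Obj C" "d \<in> Obj C" using Hom_obj j n t by auto
  have it: "i \<preceq> t" using pre[OF i(1)] comp_factors_self[OF n(1) e(1)] qi by simp
  have qj: "q \<odot> j = Zero C r Y" using q(3)[OF j(1)] factors_refl[OF j(1)] by blast
  have jt: "j \<preceq> t" using pre[OF j(1)] zero_factors[OF n(1) o(1)] qj by simp
  have corr: "\<exists>c v. v \<in> Hom C c Y \<and> monic C v \<and> is_preimage q v u"
    if u: "u \<in> Hom C s X" "monic C u" "j \<preceq> u" for s u
  proof -
    have "h \<preceq> u" if h: "h \<in> Hom C w X" "q \<odot> h = Zero C w Y" for w h
      using q(3)[OF h(1)] h(2) factors_trans[OF _ u(3) h(1) j(1) u(1)] by blast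
    then show ?thesis using obtain_image_of_preimage[OF q(1,2) u(1,2)] by metis
  qed
  have least: "t \<preceq> u" if u: "u \<in> Hom C s X" "monic C u" "i \<preceq> u" "j \<preceq> u" for s u
  proof -
    obtain c v where v: "v \<in> Hom C c Y" "monic C v" "is_preimage q v u" using corr[OF u(1,2,4)] by blast
    have "n \<odot> e \<preceq> v" using u(3) v(3) i(1) qi unfolding is_preimage_iff[OF u(1)] by metis
    obtain z s where s: "s \<in> Hom C Y z" "\<And>w g. g \<in> Hom C w Y \<Longrightarrow> s \<odot> g = Zero C w z \<longleftrightarrow> g \<preceq> v"
      using monic_is_kernel_of_epic[OF v(1,2)] by metis
    have z: "z \<in> Obj C" using Hom_obj s by auto
    have "s \<odot> (n \<odot> e) = Zero C p z" using s(2)[OF comp_hom[OF e(1) n(1)]] \<open>n \<odot> e \<preceq> v\<close> by blast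
    then have "(s \<odot> n) \<odot> e = Zero C N z \<odot> e"
      using comp_assoc[OF e(1) n(1) s(1)] zero_comp[OF e(1) z] by simp
    then have "s \<odot> n = Zero C N z" by (rule epicD[OF e(2,1) comp_hom[OF n(1) s(1)] zero_hom[OF o(2) z]])
    then have "n \<preceq> v" using s(2)[OF n(1)] by blast
    then show ?thesis using preimage_le_iff[OF q(1,2) n v(1,2) t u(1) v(3)] by blast
  qed
  have sqi: "subquotient i j N"
  proof (rule subquotientI[OF i(1) e])
    fix w h assume h: "h \<in> Hom C w p"
    have w: "w \<in> Obj C" using Hom_obj h by auto
    have "e \<odot> h = Zero C w N \<longleftrightarrow> n \<odot> (e \<odot> h) = n \<odot> Zero C w N"
      using monicD[OF n(2,1) comp_hom[OF h e(1)] zero_hom[OF w o(2)]] by auto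
    also have "\<dots> \<longleftrightarrow> q \<odot> (i \<odot> h) = Zero C w Y"
      using comp_assoc[OF h e(1) n(1)] comp_assoc[OF h i(1) q(1)] qi comp_zero[OF n(1) w] by simp
    finally show "e \<odot> h = Zero C w N \<longleftrightarrow> i \<odot> h \<preceq> j" using q(3)[OF comp_hom[OF h i(1)]] by blast
  qed
  have "q \<odot> t \<preceq> n" using pre[OF t(1)] factors_refl[OF t(1)] by blast
  then obtain e' where e': "e' \<in> Hom C d N" "q \<odot> t = n \<odot> e'"
    using factors_iff[OF comp_hom[OF t(1) q(1)] n(1)] by blast
  \<comment> \<open>The image of \<open>e'\<close> is a subobject of \<open>N\<close> with the same preimage \<open>t\<close> in \<open>X\<close>, so it is all of \<open>N\<close>.\<close>
  have "epic C e'"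
  proof -
    obtain M e'' m where e'': "e'' \<in> Hom C d M" "epic C e''" and m: "m \<in> Hom C M N" "monic C m"
        and fac: "e' = m \<odot> e''"
      using epi_mono_factorization[OF e'(1)] by metis
    have nm: "n \<odot> m \<in> Hom C M Y" "monic C (n \<odot> m)" using comp_hom[OF m(1) n(1)] monic_comp[OF m n] .
    obtain d' t' where t': "t' \<in> Hom C d' X" "is_preimage q (n \<odot> m) t'"
      using ex_preimage[OF q(1) nm] by metis
    have "q \<odot> t = (n \<odot> m) \<odot> e''" using e'(2) fac comp_assoc[OF e''(1) m(1) n(1)] by simp
    then have "q \<odot> t \<preceq> n \<odot> m" using comp_factors_self[OF nm(1) e''(1)] by simp
    then have "t \<preceq> t'" using t'(2) t(1) unfolding is_preimage_iff[OF t'(1)] by blast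
    then have "n \<preceq> n \<odot> m" using preimage_le_iff[OF q(1,2) n nm t t'] by blast
    then obtain v where v: "v \<in> Hom C N M" "n = (n \<odot> m) \<odot> v" using factors_iff[OF n(1) nm(1)] by blast
    then have "n \<odot> (m \<odot> v) = n \<odot> Ident C N"
      using comp_assoc[OF v(1) m(1) n(1)] comp_ident[OF n(1)] by metis
    then have "m \<odot> v = Ident C N"
      by (rule monicD[OF n(2,1) comp_hom[OF v(1) m(1)] ident_hom[OF o(2)]])
    then have "epic C m" using epic_cancel[OF v(1) m(1)] ident_epic[OF o(2)] by simp
    then show ?thesis using epic_comp[OF e'' m(1)] fac by simp
  qed
  have sqt: "subquotient t j N"
  proof (rule subquotientI[OF t(1) e'(1) \<open>epic C e'\<close>])
    fix w h assume h: "h \<in> Hom C w d"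
    have w: "w \<in> Obj C" using Hom_obj h by auto
    have "e' \<odot> h = Zero C w N \<longleftrightarrow> n \<odot> (e' \<odot> h) = n \<odot> Zero C w N"
      using monicD[OF n(2,1) comp_hom[OF h e'(1)] zero_hom[OF w o(2)]] by auto
    also have "\<dots> \<longleftrightarrow> q \<odot> (t \<odot> h) = Zero C w Y"
      using comp_assoc[OF h e'(1) n(1)] comp_assoc[OF h t(1) q(1)] e'(2) comp_zero[OF n(1) w] by simp
    finally show "e' \<odot> h = Zero C w N \<longleftrightarrow> t \<odot> h \<preceq> j" using q(3)[OF comp_hom[OF h t(1)]] by blast
  qed
  have inj: "x \<preceq> y"
    if x: "x \<in> Hom C s X" "monic C x" "j \<preceq> x" "x \<preceq> t"
      and y: "y \<in> Hom C s' X" "monic C y" "j \<preceq> y" "y \<preceq> t"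
      and sub: "\<And>w h. h \<in> Hom C w p \<Longrightarrow> i \<odot> h \<preceq> x \<Longrightarrow> i \<odot> h \<preceq> y" for s x s' y
  proof -
    have fac: "\<exists>c v v'. v \<in> Hom C c Y \<and> monic C v \<and> is_preimage q v u \<and>
        v' \<in> Hom C c N \<and> monic C v' \<and> v = n \<odot> v'"
      if u: "u \<in> Hom C s X" "monic C u" "j \<preceq> u" "u \<preceq> t" for s u
    proof -
      obtain c v where v: "v \<in> Hom C c Y" "monic C v" "is_preimage q v u" using corr[OF u(1-3)] by blast
      have "v \<preceq> n" using preimage_le_iff[OF q(1,2) v(1,2) n u(1) v(3) t] u(4) by blast
      then obtain v' where v': "v' \<in> Hom C c N" "v = n \<odot> v'" using factors_iff[OF v(1) n(1)] by blast
      have "monic C v'" using monic_cancel[OF v'(1) n(1)] v(2) v'(2) by simp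
      then show ?thesis using v v' by blast
    qed
    obtain c v v' where v: "v \<in> Hom C c Y" "monic C v" "is_preimage q v x"
        and v': "v' \<in> Hom C c N" "monic C v'" "v = n \<odot> v'"
      using fac[OF x] by blast
    obtain b u u' where u: "u \<in> Hom C b Y" "monic C u" "is_preimage q u y"
        and u': "u' \<in> Hom C b N" "monic C u'" "u = n \<odot> u'"
      using fac[OF y] by blast
    obtain dv kv where kv: "kv \<in> Hom C dv p" "is_preimage e v' kv" using ex_preimage[OF e(1) v'(1,2)] by metis
    obtain du ku where ku: "ku \<in> Hom C du p" "is_preimage e u' ku" using ex_preimage[OF e(1) u'(1,2)] by metis
    have trans: "i \<odot> h \<preceq> z \<longleftrightarrow> e \<odot> h \<preceq> a'"
      if h: "h \<in> Hom C w p" and z: "z \<in> Hom C sz X" "is_preimage q (n \<odot> a') z" and a': "a' \<in> Hom C ca N"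
      for w h z a' sz ca
    proof -
      have "i \<odot> h \<preceq> z \<longleftrightarrow> q \<odot> (i \<odot> h) \<preceq> n \<odot> a'"
        using z(2) comp_hom[OF h i(1)] unfolding is_preimage_iff[OF z(1)] by blast
      also have "q \<odot> (i \<odot> h) = n \<odot> (e \<odot> h)"
        using comp_assoc[OF h i(1) q(1)] comp_assoc[OF h e(1) n(1)] qi by simp
      finally show ?thesis using monic_comp_factors_iff[OF comp_hom[OF h e(1)] a' n] by blast
    qed
    have "e \<odot> kv \<preceq> v'" using kv(2) kv(1) factors_refl[OF kv(1)] unfolding is_preimage_iff[OF kv(1)] by blast
    then have "i \<odot> kv \<preceq> x" using trans[OF kv(1) x(1) _ v'(1)] v(3) v'(3) by simp
    then have "i \<odot> kv \<preceq> y" using sub[OF kv(1)] by blast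
    then have "e \<odot> kv \<preceq> u'" using trans[OF kv(1) y(1) _ u'(1)] u(3) u'(3) by simp
    then have "kv \<preceq> ku" using ku(2) kv(1) unfolding is_preimage_iff[OF ku(1)] by blast
    then have "v' \<preceq> u'" using preimage_le_iff[OF e v'(1,2) u'(1,2) kv ku] by blast
    then have "v \<preceq> u" using monic_comp_factors_iff[OF v'(1) u'(1) n] v'(3) u'(3) by simp
    then show ?thesis using preimage_le_iff[OF q(1,2) v(1,2) u(1,2) x(1) v(3) y(1) u(3)] by blast
  qed
  show thesis by (rule that[OF t(1) tm it jt least sqi sqt inj])
qed

end

section \<open>The lattice of subobjects\<close>

context category
begin

lemma monos_into_iff: "i \<in> monos_into C X \<longleftrightarrow> i \<in> Hom C (Dom C i) X \<and> monic C i"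
  unfolding monos_into_def monic_def Hom_def by auto

lemma equiv_sub_rel: "equiv (monos_into C X) (sub_rel C X)"
proof (rule equivI)
  show "sub_rel C X \<subseteq> monos_into C X \<times> monos_into C X" unfolding sub_rel_def by blast
  show "refl_on (monos_into C X) (sub_rel C X)"
    unfolding refl_on_def sub_rel_def using factors_refl monos_into_iff by blast
  show "sym (sub_rel C X)" unfolding sym_def sub_rel_def by blast
  show "trans (sub_rel C X)"
    unfolding trans_def sub_rel_def using factors_trans monos_into_iff by blast
qed

lemma SubI: "i \<in> Hom C p X \<Longrightarrow> monic C i \<Longrightarrow> sub_rel C X `` {i} \<in> Sub C X \<and> i \<in> sub_rel C X `` {i}"
  using equiv_class_self[OF equiv_sub_rel] quotientI[of i "monos_into C X" "sub_rel C X"] monos_into_iff HomD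
  unfolding Sub_def by metis

lemma Sub_rep:
  assumes "P \<in> Sub C X"
  obtains p i where "i \<in> P" "i \<in> Hom C p X" "monic C i"
proof -
  obtain i where i: "i \<in> monos_into C X" "P = sub_rel C X `` {i}"
    using assms quotientE unfolding Sub_def by metis
  then show thesis using that equiv_class_self[OF equiv_sub_rel] monos_into_iff by blast
qed

lemma Sub_mem_iff:
  assumes "P \<in> Sub C X" "i \<in> P"
  shows "j \<in> P \<longleftrightarrow> j \<in> monos_into C X \<and> i \<preceq> j \<and> j \<preceq> i"
proof -
  obtain k where k: "k \<in> monos_into C X" "P = sub_rel C X `` {k}"
    using assms quotientE unfolding Sub_def by metis
  then have "(k, i) \<in> sub_rel C X" using assms by blast
  then have "P = sub_rel C X `` {i}" using equiv_class_eq[OF equiv_sub_rel] k by metis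
  moreover have "i \<in> monos_into C X" using \<open>(k, i) \<in> sub_rel C X\<close> unfolding sub_rel_def by blast
  ultimately show ?thesis unfolding sub_rel_def by blast
qed

lemma Sub_mem_mono:
  assumes "P \<in> Sub C X" "i \<in> P"
  shows "i \<in> Hom C (Dom C i) X" "monic C i"
  using Sub_mem_iff[OF assms, of i] assms monos_into_iff by blast+

lemma sub_le_iff:
  assumes "P \<in> Sub C X" "Q \<in> Sub C X" "i \<in> P" "j \<in> Q"
  shows "sub_le C P Q \<longleftrightarrow> i \<preceq> j"
proof
  assume "sub_le C P Q"
  then obtain i' j' where ij: "i' \<in> P" "j' \<in> Q" "i' \<preceq> j'" unfolding sub_le_def by blast
  have "i \<preceq> i'" "j' \<preceq> j" using ij Sub_mem_iff[OF assms(1,3)] Sub_mem_iff[OF assms(2,4)] by blast+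
  then show "i \<preceq> j"
    using factors_trans ij(3) Sub_mem_mono(1)[OF assms(1,3)] Sub_mem_mono(1)[OF assms(1) ij(1)]
      Sub_mem_mono(1)[OF assms(2,4)] Sub_mem_mono(1)[OF assms(2) ij(2)] by meson
qed (use assms sub_le_def in blast)

lemma Sub_eqI:
  assumes "P \<in> Sub C X" "Q \<in> Sub C X" "sub_le C P Q" "sub_le C Q P"
  shows "P = Q"
proof -
  obtain p i where i: "i \<in> P" using Sub_rep[OF assms(1)] by metis
  obtain q j where j: "j \<in> Q" using Sub_rep[OF assms(2)] by metis
  have "i \<preceq> j" "j \<preceq> i" using assms sub_le_iff i j by blast+
  then have "i \<in> Q" using Sub_mem_iff[OF assms(2) j] Sub_mem_mono[OF assms(1) i] monos_into_iff by blast
  then show ?thesis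
    using Sub_mem_iff[OF assms(1) i] Sub_mem_iff[OF assms(2)] by blast
qed

lemma full_sub_mem: "X \<in> Obj C \<Longrightarrow> full_sub C X \<in> Sub C X \<and> Ident C X \<in> full_sub C X"
  unfolding full_sub_def using SubI ident_hom ident_monic by blast

lemma factors_ident: "i \<in> Hom C p X \<Longrightarrow> i \<preceq> Ident C X"
  using comp_factors_self[OF ident_hom] ident_comp Hom_obj by metis

lemma sub_le_full:
  assumes X: "X \<in> Obj C" and P: "P \<in> Sub C X"
  shows "sub_le C P (full_sub C X)"
proof -
  obtain p i where "i \<in> P" "i \<in> Hom C p X" using Sub_rep[OF P] by metis
  then show ?thesis using sub_le_iff[OF P] full_sub_mem[OF X] factors_ident by blast
qed

end

definition sub_order :: "('o, 'm, 'z) cat_scheme \<Rightarrow> 'o \<Rightarrow> 'm set gorder" where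
  "sub_order C X = \<lparr>carrier = Sub C X, eq = (=), le = sub_le C\<rparr>"

lemma sub_order_simps [simp]:
  "carrier (sub_order C X) = Sub C X" "eq (sub_order C X) = (=)" "le (sub_order C X) = sub_le C"
  unfolding sub_order_def by simp_all

context abelian_category
begin

lemma obtain_zero_mono:
  assumes X: "X \<in> Obj C"
  obtains z where "zero_object C z" "Zero C z X \<in> Hom C z X" "monic C (Zero C z X)"
proof -
  obtain z where z: "zero_object C z" using ex_zero_object by blast
  then have zo: "z \<in> Obj C" unfolding zero_object_def by blast
  have "g = h" if "g \<in> Hom C w z" "h \<in> Hom C w z" for w g h
    using z Hom_obj(1)[OF that(1)] that unfolding zero_object_def by blast
  then have "monic C (Zero C z X)" using monic_iff[OF zero_hom[OF zo X]] by blast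
  then show thesis using that z zero_hom[OF zo X] by blast
qed

lemma zero_sub_mem_iff:
  "i \<in> zero_sub C X \<longleftrightarrow> i \<in> Hom C (Dom C i) X \<and> monic C i \<and> i = Zero C (Dom C i) X"
  unfolding zero_sub_def using monos_into_iff monic_zero_iff by blast

lemma zero_sub_in_Sub:
  assumes X: "X \<in> Obj C"
  shows "zero_sub C X \<in> Sub C X" and "\<And>i. i \<in> zero_sub C X \<Longrightarrow> zero_sub C X = sub_rel C X `` {i}"
    and "zero_sub C X \<noteq> {}"
proof -
  show eq: "zero_sub C X = sub_rel C X `` {i}" if i: "i \<in> zero_sub C X" for i
  proof (rule Set.set_eqI)
    fix j
    have i': "i \<in> Hom C (Dom C i) X" "monic C i" "i = Zero C (Dom C i) X"
      using i zero_sub_mem_iff by blast+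
    have "j \<in> sub_rel C X `` {i} \<longleftrightarrow> j \<in> Hom C (Dom C j) X \<and> monic C j \<and> i \<preceq> j \<and> j \<preceq> i"
      unfolding sub_rel_def using i' monos_into_iff by auto
    also have "\<dots> \<longleftrightarrow> j \<in> zero_sub C X"
    proof
      assume j: "j \<in> Hom C (Dom C j) X \<and> monic C j \<and> i \<preceq> j \<and> j \<preceq> i"
      then obtain h where h: "h \<in> Hom C (Dom C j) (Dom C i)" "j = i \<odot> h"
        using factors_iff[of j "Dom C j" X i "Dom C i"] i' by blast
      have "Zero C (Dom C i) X \<odot> h = Zero C (Dom C j) X" using zero_comp[OF h(1) X] .
      then have "j = Zero C (Dom C j) X" using h(2) i'(3) by simp
      then show "j \<in> zero_sub C X" using j zero_sub_mem_iff by blast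
    next
      assume "j \<in> zero_sub C X"
      then have j: "j \<in> Hom C (Dom C j) X" "monic C j" "j = Zero C (Dom C j) X"
        using zero_sub_mem_iff by blast+
      have "Zero C (Dom C i) X \<preceq> j" "Zero C (Dom C j) X \<preceq> i"
        using zero_factors[OF j(1) Hom_obj(1)[OF i'(1)]] zero_factors[OF i'(1) Hom_obj(1)[OF j(1)]] .
      then show "j \<in> Hom C (Dom C j) X \<and> monic C j \<and> i \<preceq> j \<and> j \<preceq> i" using i' j by simp
    qed
    finally show "j \<in> zero_sub C X \<longleftrightarrow> j \<in> sub_rel C X `` {i}" by blast
  qed
  obtain z where z: "Zero C z X \<in> Hom C z X" "monic C (Zero C z X)" using obtain_zero_mono[OF X] by metis
  then have mem: "Zero C z X \<in> zero_sub C X" using HomD zero_sub_mem_iff by metis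
  then show "zero_sub C X \<noteq> {}" by blast
  show "zero_sub C X \<in> Sub C X" using eq[OF mem] SubI[OF z] by simp
qed

lemma zero_sub_le:
  assumes X: "X \<in> Obj C" and P: "P \<in> Sub C X"
  shows "sub_le C (zero_sub C X) P"
proof -
  obtain i where i: "i \<in> zero_sub C X" using zero_sub_in_Sub(3)[OF X] by blast
  then have i': "i \<in> Hom C (Dom C i) X" "i = Zero C (Dom C i) X" using zero_sub_mem_iff by blast+
  obtain q j where j: "j \<in> P" "j \<in> Hom C q X" using Sub_rep[OF P] by metis
  have "i \<preceq> j" using zero_factors[OF j(2) Hom_obj(1)[OF i'(1)]] i'(2) by simp
  then show ?thesis using i j unfolding sub_le_def by blast
qed

text \<open>
Simplicity speaks of equivalence classes of monomorphisms; this rephrases it for single ones.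
\<close>

lemma simple_object_iff:
  "simple_object C Z \<longleftrightarrow> Z \<in> Obj C \<and> \<not> zero_object C Z \<and>
     (\<forall>c. \<forall>n\<in>Hom C c Z. monic C n \<longrightarrow> n = Zero C c Z \<or> Ident C Z \<preceq> n)"
proof (cases "Z \<in> Obj C")
  case Z: True
  have zero: "P = zero_sub C Z \<longleftrightarrow> n = Zero C c Z"
    if P: "P \<in> Sub C Z" and n: "n \<in> P" "n \<in> Hom C c Z" "monic C n" for P n c
  proof -
    have "P = zero_sub C Z \<longleftrightarrow> n \<in> zero_sub C Z"
    proof
      assume "n \<in> zero_sub C Z"
      then have "zero_sub C Z = sub_rel C Z `` {n}" using zero_sub_in_Sub(2)[OF Z] by blast
      moreover have "P = sub_rel C Z `` {n}"
        using Sub_mem_iff[OF P n(1)] n monos_into_iff HomD[OF n(2)] unfolding sub_rel_def by blast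
      ultimately show "P = zero_sub C Z" by simp
    qed (use n in simp)
    then show ?thesis using zero_sub_mem_iff[of n Z] n HomD[OF n(2)] by simp
  qed
  have full: "P = full_sub C Z \<longleftrightarrow> Ident C Z \<preceq> n"
    if P: "P \<in> Sub C Z" and n: "n \<in> P" for P n
    using Sub_eqI[OF P, of "full_sub C Z"] sub_le_full[OF Z P] full_sub_mem[OF Z]
      sub_le_iff[OF _ P _ n, of "full_sub C Z" "Ident C Z"] Sub_mem_iff[OF P n] by metis
  have two: "Sub C Z = {zero_sub C Z, full_sub C Z} \<longleftrightarrow> (\<forall>P\<in>Sub C Z. P = zero_sub C Z \<or> P = full_sub C Z)"
    using zero_sub_in_Sub(1)[OF Z] full_sub_mem[OF Z] by blast
  have each: "(\<forall>P\<in>Sub C Z. P = zero_sub C Z \<or> P = full_sub C Z) \<longleftrightarrow>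
      (\<forall>c. \<forall>n\<in>Hom C c Z. monic C n \<longrightarrow> n = Zero C c Z \<or> Ident C Z \<preceq> n)"
  proof
    assume l: "\<forall>P\<in>Sub C Z. P = zero_sub C Z \<or> P = full_sub C Z"
    show "\<forall>c. \<forall>n\<in>Hom C c Z. monic C n \<longrightarrow> n = Zero C c Z \<or> Ident C Z \<preceq> n"
    proof (intro allI ballI impI)
      fix c n assume n: "n \<in> Hom C c Z" "monic C n"
      have P: "sub_rel C Z `` {n} \<in> Sub C Z" "n \<in> sub_rel C Z `` {n}" using SubI[OF n] by blast+
      have "sub_rel C Z `` {n} = zero_sub C Z \<or> sub_rel C Z `` {n} = full_sub C Z" using l P(1) ..
      then show "n = Zero C c Z \<or> Ident C Z \<preceq> n" unfolding zero[OF P n] full[OF P] .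
    qed
  next
    assume r: "\<forall>c. \<forall>n\<in>Hom C c Z. monic C n \<longrightarrow> n = Zero C c Z \<or> Ident C Z \<preceq> n"
    show "\<forall>P\<in>Sub C Z. P = zero_sub C Z \<or> P = full_sub C Z"
    proof
      fix P assume P: "P \<in> Sub C Z"
      then obtain c n where n: "n \<in> P" "n \<in> Hom C c Z" "monic C n" using Sub_rep by metis
      show "P = zero_sub C Z \<or> P = full_sub C Z"
        unfolding zero[OF P n] full[OF P n(1)] using r n(2,3) by blast
    qed
  qed
  show ?thesis unfolding simple_object_def two each using Z by blast
qed (simp add: simple_object_def)

text \<open>
The correspondence theorem for \<open>e : t \<rightarrow> Z\<close>: the subobjects of \<open>Z\<close> are those between \<open>i\<close> and \<open>t\<close>, with
\<open>0\<close> corresponding to \<open>i\<close> and \<open>Z\<close> to \<open>t\<close>.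
\<close>

lemma simple_subquotient_iff:
  assumes t: "t \<in> Hom C d X" "monic C t" and i: "i \<in> Hom C p X" "monic C i" and it: "i \<preceq> t"
    and sq: "subquotient t i Z"
  shows "simple_object C Z \<longleftrightarrow> \<not> t \<preceq> i \<and>
    (\<forall>c. \<forall>l\<in>Hom C c X. monic C l \<and> i \<preceq> l \<and> l \<preceq> t \<longrightarrow> l \<preceq> i \<or> t \<preceq> l)" (is "_ \<longleftrightarrow> _ \<and> ?max")
proof -
  obtain e where e: "e \<in> Hom C d Z" "epic C e"
      "\<And>w h. h \<in> Hom C w d \<Longrightarrow> e \<odot> h = Zero C w Z \<longleftrightarrow> t \<odot> h \<preceq> i"
    using subquotientE[OF sq t(1)] by metis
  have Z: "Z \<in> Obj C" and d: "d \<in> Obj C" using Hom_obj e by auto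
  have idd: "Ident C d \<in> Hom C d d" and idZ: "Ident C Z \<in> Hom C Z Z" using ident_hom d Z by auto
  have tid: "t \<odot> Ident C d = t" "e \<odot> Ident C d = e" using comp_ident t e by auto
  have "zero_object C Z \<longleftrightarrow> Ident C Z \<odot> e = Zero C Z Z \<odot> e"
    using zero_object_iff[OF Z] epicD[OF e(2,1) idZ zero_hom[OF Z Z]] by auto
  also have "\<dots> \<longleftrightarrow> e \<odot> Ident C d = Zero C d Z"
    using ident_comp[OF e(1)] zero_comp[OF e(1) Z] tid by simp
  finally have zero: "zero_object C Z \<longleftrightarrow> t \<preceq> i" using e(3)[OF idd] tid by simp
  have "(\<forall>c. \<forall>n\<in>Hom C c Z. monic C n \<longrightarrow> n = Zero C c Z \<or> Ident C Z \<preceq> n) \<longleftrightarrow> ?max"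
  proof
    assume A: "\<forall>c. \<forall>n\<in>Hom C c Z. monic C n \<longrightarrow> n = Zero C c Z \<or> Ident C Z \<preceq> n"
    show ?max
    proof (intro allI ballI impI)
      fix c l assume l: "l \<in> Hom C c X" and l': "monic C l \<and> i \<preceq> l \<and> l \<preceq> t"
      obtain k where k: "k \<in> Hom C c d" "l = t \<odot> k" using factors_iff[OF l t(1)] l' by blast
      have km: "monic C k" using monic_cancel[OF k(1) t(1)] k(2) l' by simp
      have "h \<preceq> k" if h: "h \<in> Hom C w d" "e \<odot> h = Zero C w Z" for w h
      proof -
        have "t \<odot> h \<preceq> l" using e(3)[OF h(1)] h(2) factors_trans[OF _ _ comp_hom[OF h(1) t(1)] i(1) l] l' by blast
        then show ?thesis using monic_comp_factors_iff[OF h(1) k(1) t] k(2) by simp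
      qed
      then obtain b n where n: "n \<in> Hom C b Z" "monic C n" "is_preimage e n k"
        using obtain_image_of_preimage[OF e(1,2) k(1) km] by metis
      have pre: "\<And>w h. h \<in> Hom C w d \<Longrightarrow> h \<preceq> k \<longleftrightarrow> e \<odot> h \<preceq> n"
        using n(3) unfolding is_preimage_iff[OF k(1)] by blast
      from A n have "n = Zero C b Z \<or> Ident C Z \<preceq> n" by blast
      then show "l \<preceq> i \<or> t \<preceq> l"
      proof
        assume nz: "n = Zero C b Z"
        have "e \<odot> k \<preceq> n" using pre[OF k(1)] factors_refl[OF k(1)] by blast
        then obtain h where "h \<in> Hom C c b" "e \<odot> k = n \<odot> h"
          using factors_iff[OF comp_hom[OF k(1) e(1)] n(1)] by blast
        then have "e \<odot> k = Zero C c Z" using nz zero_comp Z by simp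
        then show ?thesis using e(3)[OF k(1)] k(2) by blast
      next
        assume "Ident C Z \<preceq> n"
        then have "Ident C Z \<odot> e \<preceq> n" using factors_comp_right[OF _ idZ n(1) e(1)] by blast
        then have "Ident C d \<preceq> k" using pre[OF idd] tid ident_comp[OF e(1)] by simp
        then have "t \<odot> Ident C d \<preceq> t \<odot> k" using factors_comp_left[OF _ idd k(1) t(1)] by blast
        then show ?thesis using tid k(2) by simp
      qed
    qed
  next
    assume B: ?max
    show "\<forall>c. \<forall>n\<in>Hom C c Z. monic C n \<longrightarrow> n = Zero C c Z \<or> Ident C Z \<preceq> n"
    proof (intro allI ballI impI)
      fix c n assume n: "n \<in> Hom C c Z" "monic C n"
      obtain b k where k: "k \<in> Hom C b d" "is_preimage e n k" using ex_preimage[OF e(1) n] by metis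
      have km: "monic C k" and pre: "\<And>w h. h \<in> Hom C w d \<Longrightarrow> h \<preceq> k \<longleftrightarrow> e \<odot> h \<preceq> n"
        using k(2) unfolding is_preimage_iff[OF k(1)] by blast+
      have l: "t \<odot> k \<in> Hom C b X" "monic C (t \<odot> k)" "t \<odot> k \<preceq> t"
        using comp_hom[OF k(1) t(1)] monic_comp[OF k(1) km t] comp_factors_self[OF t(1) k(1)] .
      obtain h where h: "h \<in> Hom C p d" "i = t \<odot> h" using factors_iff[OF i(1) t(1)] it by blast
      have "e \<odot> h = Zero C p Z" using e(3)[OF h(1)] h(2) factors_refl[OF i(1)] by simp
      then have "h \<preceq> k" using pre[OF h(1)] zero_factors[OF n(1) Hom_obj(1)[OF i(1)]] by simp
      then have "i \<preceq> t \<odot> k" using factors_comp_left[OF _ h(1) k(1) t(1)] h(2) by simp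
      then have "t \<odot> k \<preceq> i \<or> t \<preceq> t \<odot> k" using B l by blast
      then show "n = Zero C c Z \<or> Ident C Z \<preceq> n"
      proof
        assume "t \<odot> k \<preceq> i"
        then have ek: "e \<odot> k = Zero C b Z" using e(3)[OF k(1)] by blast
        obtain z where z: "zero_object C z" "Zero C z Z \<in> Hom C z Z" "monic C (Zero C z Z)"
          using obtain_zero_mono[OF Z] .
        obtain y m where m: "m \<in> Hom C y d" "is_preimage e (Zero C z Z) m"
          using ex_preimage[OF e(1) z(2,3)] by metis
        have "e \<odot> k \<preceq> Zero C z Z" using ek zero_factors[OF z(2) Hom_obj(1)[OF k(1)]] by simp
        then have "k \<preceq> m" using m(2) k(1) unfolding is_preimage_iff[OF m(1)] by blast
        then have "n \<preceq> Zero C z Z" using preimage_le_iff[OF e(1,2) n z(2,3) k m] by blast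
        then obtain g where "g \<in> Hom C c z" "n = Zero C z Z \<odot> g" using factors_iff[OF n(1) z(2)] by blast
        then show ?thesis using zero_comp Z by simp
      next
        assume "t \<preceq> t \<odot> k"
        then have "Ident C d \<preceq> k" using monic_comp_factors_iff[OF idd k(1) t] tid by simp
        moreover have "is_preimage e (Ident C Z) (Ident C d)"
          unfolding is_preimage_iff[OF idd]
          using ident_monic[OF d] factors_ident comp_hom[OF _ e(1)] by blast
        ultimately show ?thesis
          using preimage_le_iff[OF e(1,2) idZ ident_monic[OF Z] n idd _ k] by blast
      qed
    qed
  qed
  then show ?thesis unfolding simple_object_iff using Z zero by blast
qed

text \<open>
The defining condition asks for suitable representatives of \<open>P\<close> and \<open>Q\<close>; any representatives will do.
\<close>

lemma is_quotient_iff: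
  assumes P: "P \<in> Sub C X" "i \<in> P" and Q: "Q \<in> Sub C X" "j \<in> Q" and le: "sub_le C P Q"
  shows "is_quotient C Q P Z \<longleftrightarrow> subquotient j i Z"
proof
  assume "is_quotient C Q P Z"
  then obtain i' j' h q where r: "i' \<in> P" "j' \<in> Q" "h \<in> Hom C (Dom C i') (Dom C j')" "i' = j' \<odot> h"
      "is_cokernel C h q" "Cod C q = Z"
    unfolding is_quotient_def by blast
  have i': "i' \<in> Hom C (Dom C i') X" "monic C i'" using Sub_mem_mono[OF P(1) r(1)] .
  have j': "j' \<in> Hom C (Dom C j') X" "monic C j'" using Sub_mem_mono[OF Q(1) r(2)] .
  have "q \<in> Hom C (Dom C j') Z"
    using r(5,6) HomD[OF r(3)] unfolding is_cokernel_def Hom_def by simp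
  then have sq: "subquotient j' i' Z" using subquotient_iff_cokernel[OF i' j' r(3,4)] r(5) by blast
  have j: "j \<in> Hom C (Dom C j) X" "monic C j" using Sub_mem_mono[OF Q] .
  have ii: "i \<preceq> i'" "i' \<preceq> i" using Sub_mem_iff[OF P] r(1) by blast+
  have i: "i \<in> Hom C (Dom C i) X" using Sub_mem_mono[OF P] by blast
  have jj: "j' \<preceq> j" "j \<preceq> j'" using Sub_mem_iff[OF Q] r(2) by blast+
  have "h \<preceq> i' \<longleftrightarrow> h \<preceq> i" if h: "h \<in> Hom C w X" for w h
    using factors_trans[OF _ ii(2) h i'(1) i] factors_trans[OF _ ii(1) h i i'(1)] by blast
  then show "subquotient j i Z" using subquotient_cong[OF j' j jj _ sq] by blast
next
  assume sq: "subquotient j i Z"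
  have i: "i \<in> Hom C (Dom C i) X" "monic C i" and j: "j \<in> Hom C (Dom C j) X" "monic C j"
    using Sub_mem_mono P Q by blast+
  have "i \<preceq> j" using sub_le_iff P Q le by blast
  then obtain h where h: "h \<in> Hom C (Dom C i) (Dom C j)" "i = j \<odot> h" using factors_iff[OF i(1) j(1)] by blast
  obtain q where "q \<in> Hom C (Dom C j) Z" "is_cokernel C h q"
    using subquotient_iff_cokernel[OF i j h] sq by blast
  then show "is_quotient C Q P Z" unfolding is_quotient_def using P Q h HomD by metis
qed

lemma quotient_object_subquotient:
  assumes P: "P \<in> Sub C X" "i \<in> P" and Q: "Q \<in> Sub C X" "j \<in> Q" and le: "sub_le C P Q"
  shows "subquotient j i (quotient_object C Q P)"
proof -
  have i: "i \<in> Hom C (Dom C i) X" "monic C i" and j: "j \<in> Hom C (Dom C j) X" "monic C j"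
    using Sub_mem_mono P Q by blast+
  have "i \<preceq> j" using sub_le_iff P Q le by blast
  then obtain h where h: "h \<in> Hom C (Dom C i) (Dom C j)" "i = j \<odot> h" using factors_iff[OF i(1) j(1)] by blast
  obtain q where "is_cokernel C h q" using ex_cokernel HomD(1)[OF h(1)] by blast
  then have "is_quotient C Q P (Cod C q)" unfolding is_quotient_def using P Q h by blast
  then have "is_quotient C Q P (quotient_object C Q P)" unfolding quotient_object_def by (rule someI)
  then show ?thesis using is_quotient_iff[OF assms] by blast
qed

lemma sub_order_lattice:
  assumes X: "X \<in> Obj C"
  shows "bounded_lattice (sub_order C X)"
proof -
  let ?L = "sub_order C X"
  have refl: "sub_le C P P" if P: "P \<in> Sub C X" for P
  proof -
    obtain p i where "i \<in> P" "i \<in> Hom C p X" using Sub_rep[OF P] by metis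
    then show ?thesis using factors_refl unfolding sub_le_def by blast
  qed
  have tr: "sub_le C P R" if PQR: "P \<in> Sub C X" "Q \<in> Sub C X" "R \<in> Sub C X"
      and le: "sub_le C P Q" "sub_le C Q R" for P Q R
  proof -
    obtain p i where i: "i \<in> P" "i \<in> Hom C p X" using Sub_rep[OF PQR(1)] by metis
    obtain q j where j: "j \<in> Q" "j \<in> Hom C q X" using Sub_rep[OF PQR(2)] by metis
    obtain r k where k: "k \<in> R" "k \<in> Hom C r X" using Sub_rep[OF PQR(3)] by metis
    have "i \<preceq> j" "j \<preceq> k" using sub_le_iff PQR le i j k by blast+
    then have "i \<preceq> k" using factors_trans i(2) j(2) k(2) by blast
    then show ?thesis using i k unfolding sub_le_def by blast
  qed
  interpret partial_order ?L
  proof (unfold_locales, goal_cases)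
    case 4 then show ?case using refl by simp
  next
    case (5 P Q) then show ?case using Sub_eqI by simp
  next
    case (6 P Q R) then show ?case using tr[of P Q R] by simp
  qed simp_all
  have join: "\<exists>s. least ?L s (Upper ?L {P, Q})" if PQ: "P \<in> Sub C X" "Q \<in> Sub C X" for P Q
  proof -
    obtain p i where i: "i \<in> P" "i \<in> Hom C p X" "monic C i" using Sub_rep[OF PQ(1)] .
    obtain q j where j: "j \<in> Q" "j \<in> Hom C q X" "monic C j" using Sub_rep[OF PQ(2)] .
    obtain d t where t: "t \<in> Hom C d X" "monic C t" "i \<preceq> t" "j \<preceq> t"
        and least: "\<And>s u. \<lbrakk>u \<in> Hom C s X; monic C u; i \<preceq> u; j \<preceq> u\<rbrakk> \<Longrightarrow> t \<preceq> u"
      using diamond[OF i(2,3) j(2,3)] by metis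
    let ?T = "sub_rel C X `` {t}"
    have T: "?T \<in> Sub C X" "t \<in> ?T" using SubI[OF t(1,2)] by blast+
    have "least ?L ?T (Upper ?L {P, Q})"
    proof (rule least_UpperI)
      fix x assume "x \<in> {P, Q}"
      then show "x \<sqsubseteq>\<^bsub>?L\<^esub> ?T" using t i j T PQ sub_le_iff[OF _ T(1) _ T(2)] by auto
    next
      fix y assume "y \<in> Upper ?L {P, Q}"
      then have y: "y \<in> Sub C X" "sub_le C P y" "sub_le C Q y" using PQ unfolding Upper_def by auto
      obtain s u where u: "u \<in> y" "u \<in> Hom C s X" "monic C u" using Sub_rep[OF y(1)] .
      have "i \<preceq> u" "j \<preceq> u" using sub_le_iff PQ y i j u by blast+
      then show "?T \<sqsubseteq>\<^bsub>?L\<^esub> y" using least[OF u(2,3)] sub_le_iff[OF T(1) y(1) T(2) u(1)] by simp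
    qed (use PQ T in auto)
    then show ?thesis by blast
  qed
  have meet: "\<exists>s. greatest ?L s (Lower ?L {P, Q})" if PQ: "P \<in> Sub C X" "Q \<in> Sub C X" for P Q
  proof -
    obtain p i where i: "i \<in> P" "i \<in> Hom C p X" "monic C i" using Sub_rep[OF PQ(1)] .
    obtain q j where j: "j \<in> Q" "j \<in> Hom C q X" "monic C j" using Sub_rep[OF PQ(2)] .
    obtain d m where m: "m \<in> Hom C d X" "monic C m"
        "\<And>w h. h \<in> Hom C w X \<Longrightarrow> h \<preceq> m \<longleftrightarrow> h \<preceq> i \<and> h \<preceq> j"
      using obtain_meet[OF i(2,3) j(2,3)] by metis
    let ?T = "sub_rel C X `` {m}"
    have T: "?T \<in> Sub C X" "m \<in> ?T" using SubI[OF m(1,2)] by blast+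
    have mm: "m \<preceq> i" "m \<preceq> j" using m(3)[OF m(1)] factors_refl[OF m(1)] by blast+
    have "greatest ?L ?T (Lower ?L {P, Q})"
    proof (rule greatest_LowerI)
      fix x assume "x \<in> {P, Q}"
      then show "?T \<sqsubseteq>\<^bsub>?L\<^esub> x" using mm i j T PQ sub_le_iff[OF T(1) _ T(2)] by auto
    next
      fix y assume "y \<in> Lower ?L {P, Q}"
      then have y: "y \<in> Sub C X" "sub_le C y P" "sub_le C y Q" using PQ unfolding Lower_def by auto
      obtain s u where u: "u \<in> y" "u \<in> Hom C s X" "monic C u" using Sub_rep[OF y(1)] .
      have "u \<preceq> i" "u \<preceq> j" using sub_le_iff PQ y i j u by blast+
      then show "y \<sqsubseteq>\<^bsub>?L\<^esub> ?T" using m(3)[OF u(2)] sub_le_iff[OF y(1) T(1) u(1) T(2)] by simp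
    qed (use PQ T in auto)
    then show ?thesis by blast
  qed
  have bot: "least ?L (zero_sub C X) (carrier ?L)"
    unfolding least_def using zero_sub_in_Sub[OF X] zero_sub_le[OF X] by simp
  have top: "greatest ?L (full_sub C X) (carrier ?L)"
    unfolding greatest_def using full_sub_mem[OF X] sub_le_full[OF X] by simp
  show ?thesis
  proof (unfold_locales, goal_cases)
    case (1 x y) then show ?case using join by simp
  next
    case (2 x y) then show ?case using meet by simp
  next
    case 3 show ?case using bot by blast
  next
    case 4 show ?case using top by blast
  qed
qed

lemma sub_meet_iff:
  assumes X: "X \<in> Obj C" and P: "P \<in> Sub C X" "i \<in> P" and Q: "Q \<in> Sub C X" "j \<in> Q"
    and m: "m \<in> P \<sqinter>\<^bsub>sub_order C X\<^esub> Q" and h: "h \<in> Hom C w X"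
  shows "h \<preceq> m \<longleftrightarrow> h \<preceq> i \<and> h \<preceq> j"
proof -
  let ?L = "sub_order C X"
  interpret bounded_lattice ?L using sub_order_lattice[OF X] .
  have M: "P \<sqinter>\<^bsub>?L\<^esub> Q \<in> Sub C X" using meet_closed[of P Q] P Q by simp
  have i: "i \<in> Hom C (Dom C i) X" "monic C i" and j: "j \<in> Hom C (Dom C j) X" "monic C j"
    and mh: "m \<in> Hom C (Dom C m) X" using Sub_mem_mono P Q M m by blast+
  have "sub_le C (P \<sqinter>\<^bsub>?L\<^esub> Q) P" "sub_le C (P \<sqinter>\<^bsub>?L\<^esub> Q) Q"
    using meet_left[of P Q] meet_right[of P Q] P Q by simp_all
  then have mij: "m \<preceq> i" "m \<preceq> j" using sub_le_iff[OF M] P Q m by blast+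
  obtain d m0 where m0: "m0 \<in> Hom C d X" "monic C m0"
      "\<And>w h. h \<in> Hom C w X \<Longrightarrow> h \<preceq> m0 \<longleftrightarrow> h \<preceq> i \<and> h \<preceq> j"
    using obtain_meet[OF i j] by metis
  let ?M = "sub_rel C X `` {m0}"
  have M0: "?M \<in> Sub C X" "m0 \<in> ?M" using SubI[OF m0(1,2)] by blast+
  have "m0 \<preceq> i" "m0 \<preceq> j" using m0(3)[OF m0(1)] factors_refl[OF m0(1)] by blast+
  then have "sub_le C ?M P" "sub_le C ?M Q" using sub_le_iff M0 P Q by blast+
  then have "sub_le C ?M (P \<sqinter>\<^bsub>?L\<^esub> Q)" using meet_le[of ?M P Q] M0 P Q by simp
  then have m0m: "m0 \<preceq> m" using sub_le_iff M0 M m by blast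
  show ?thesis
  proof
    assume "h \<preceq> m"
    then show "h \<preceq> i \<and> h \<preceq> j"
      using factors_trans[OF _ mij(1) h mh i(1)] factors_trans[OF _ mij(2) h mh j(1)] by blast
  next
    assume "h \<preceq> i \<and> h \<preceq> j"
    then show "h \<preceq> m" using m0(3)[OF h] factors_trans[OF _ m0m h m0(1) mh] by blast
  qed
qed

text \<open>
Transfers \<open>diamond\<close> to arbitrary representatives of \<open>P\<close>, \<open>Q\<close> and their join.
\<close>

lemma sub_diamond:
  assumes X: "X \<in> Obj C" and P: "P \<in> Sub C X" "i \<in> P" and Q: "Q \<in> Sub C X" "j \<in> Q"
    and t: "t \<in> P \<squnion>\<^bsub>sub_order C X\<^esub> Q"
  obtains N where "subquotient i j N" "subquotient t j N"
    "\<And>U V u v. \<lbrakk>U \<in> Sub C X; u \<in> U; V \<in> Sub C X; v \<in> V; j \<preceq> u; u \<preceq> t; j \<preceq> v; v \<preceq> t;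
       \<And>w h. h \<in> Hom C w (Dom C i) \<Longrightarrow> i \<odot> h \<preceq> u \<Longrightarrow> i \<odot> h \<preceq> v\<rbrakk> \<Longrightarrow> u \<preceq> v"
proof -
  let ?L = "sub_order C X"
  interpret bounded_lattice ?L using sub_order_lattice[OF X] .
  have T: "P \<squnion>\<^bsub>?L\<^esub> Q \<in> Sub C X" using join_closed[of P Q] P Q by simp
  have i: "i \<in> Hom C (Dom C i) X" "monic C i" and j: "j \<in> Hom C (Dom C j) X" "monic C j"
    and th: "t \<in> Hom C (Dom C t) X" "monic C t" using Sub_mem_mono P Q T t by blast+
  have "sub_le C P (P \<squnion>\<^bsub>?L\<^esub> Q)" "sub_le C Q (P \<squnion>\<^bsub>?L\<^esub> Q)"
    using join_left[of P Q] join_right[of P Q] P Q by simp_all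
  then have ijt: "i \<preceq> t" "j \<preceq> t" using sub_le_iff[OF _ T] P Q t by blast+
  obtain d t0 N where t0: "t0 \<in> Hom C d X" "monic C t0" "i \<preceq> t0" "j \<preceq> t0"
    and least: "\<And>s u. \<lbrakk>u \<in> Hom C s X; monic C u; i \<preceq> u; j \<preceq> u\<rbrakk> \<Longrightarrow> t0 \<preceq> u"
    and N: "subquotient i j N" "subquotient t0 j N"
    and inj: "\<And>s x s' y. \<lbrakk>x \<in> Hom C s X; monic C x; j \<preceq> x; x \<preceq> t0; y \<in> Hom C s' X; monic C y; j \<preceq> y; y \<preceq> t0;
       \<And>w h. h \<in> Hom C w (Dom C i) \<Longrightarrow> i \<odot> h \<preceq> x \<Longrightarrow> i \<odot> h \<preceq> y\<rbrakk> \<Longrightarrow> x \<preceq> y"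
    by (rule diamond[OF i j]) blast
  let ?T = "sub_rel C X `` {t0}"
  have T0: "?T \<in> Sub C X" "t0 \<in> ?T" using SubI[OF t0(1,2)] by blast+
  have "sub_le C P ?T" "sub_le C Q ?T" using sub_le_iff T0 P Q t0 by blast+
  then have "sub_le C (P \<squnion>\<^bsub>?L\<^esub> Q) ?T" using join_le[of P ?T Q] T0 P Q by simp
  then have tt0: "t \<preceq> t0" using sub_le_iff T0 T t by blast
  have t0t: "t0 \<preceq> t" using least[OF th ijt] .
  have "subquotient t j N" using subquotient_cong[OF t0(1,2) th t0t tt0 _ N(2)] by blast
  moreover have "u \<preceq> v" if U: "U \<in> Sub C X" "u \<in> U" and V: "V \<in> Sub C X" "v \<in> V"
      and le: "j \<preceq> u" "u \<preceq> t" "j \<preceq> v" "v \<preceq> t"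
      and sub: "\<And>w h. h \<in> Hom C w (Dom C i) \<Longrightarrow> i \<odot> h \<preceq> u \<Longrightarrow> i \<odot> h \<preceq> v" for U V u v
  proof -
    note u = Sub_mem_mono[OF U] and v = Sub_mem_mono[OF V]
    show ?thesis
    proof (rule inj[OF u le(1) _ v le(3)])
      show "u \<preceq> t0" "v \<preceq> t0"
        using factors_trans[OF le(2) tt0 u(1) th(1) t0(1)] factors_trans[OF le(4) tt0 v(1) th(1) t0(1)] .
    qed (rule sub)
  qed
  ultimately show thesis by (rule that[OF N(1)])
qed

text \<open>
Both sides of the modular law lie between \<open>Q\<close> and \<open>P \<squnion> Q\<close>, so by \<open>sub_diamond\<close> it is enough to compare
their intersections with \<open>P\<close>, and there the left side is contained in \<open>P \<sqinter> R\<close>.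
\<close>

lemma sub_order_modular:
  assumes X: "X \<in> Obj C"
  shows "modular_bounded_lattice (sub_order C X)"
proof -
  let ?L = "sub_order C X"
  interpret bounded_lattice ?L using sub_order_lattice[OF X] .
  show ?thesis
  proof
    fix Q P R assume c: "Q \<in> carrier ?L" "P \<in> carrier ?L" "R \<in> carrier ?L" and le: "Q \<sqsubseteq>\<^bsub>?L\<^esub> R"
    \<comment> \<open>\<open>U\<close> and \<open>V\<close> are the two sides of the law, both between \<open>Q\<close> and \<open>T\<close>.\<close>
    define T U W V where "T = P \<squnion>\<^bsub>?L\<^esub> Q" and "U = T \<sqinter>\<^bsub>?L\<^esub> R" and "W = P \<sqinter>\<^bsub>?L\<^esub> R" and "V = Q \<squnion>\<^bsub>?L\<^esub> W"
    note defs = T_def U_def V_def W_def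
    have cl: "T \<in> carrier ?L" "U \<in> carrier ?L" "V \<in> carrier ?L" "W \<in> carrier ?L"
      unfolding defs using c by (simp_all del: sub_order_simps)
    have QT: "Q \<sqsubseteq>\<^bsub>?L\<^esub> T" and PT: "P \<sqsubseteq>\<^bsub>?L\<^esub> T"
      unfolding T_def using c join_left join_right by blast+
    have UT: "U \<sqsubseteq>\<^bsub>?L\<^esub> T" and UR: "U \<sqsubseteq>\<^bsub>?L\<^esub> R"
      unfolding U_def using c cl meet_left meet_right by blast+
    have QU: "Q \<sqsubseteq>\<^bsub>?L\<^esub> U" unfolding U_def using meet_le[OF QT le] c cl by blast
    have QV: "Q \<sqsubseteq>\<^bsub>?L\<^esub> V" and WV: "W \<sqsubseteq>\<^bsub>?L\<^esub> V"
      unfolding V_def using c cl join_left join_right by blast+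
    have "W \<sqsubseteq>\<^bsub>?L\<^esub> P" unfolding W_def using c meet_left by blast
    then have "W \<sqsubseteq>\<^bsub>?L\<^esub> T" using PT le_trans c cl by blast
    then have VT: "V \<sqsubseteq>\<^bsub>?L\<^esub> T" unfolding V_def using join_le[OF QT] c cl by blast
    have S: "Q \<in> Sub C X" "P \<in> Sub C X" "R \<in> Sub C X" "T \<in> Sub C X" "U \<in> Sub C X" "V \<in> Sub C X" "W \<in> Sub C X"
      using c cl by simp_all
    obtain i j k t u v w where mem: "i \<in> P" "j \<in> Q" "k \<in> R" "t \<in> T" "u \<in> U" "v \<in> V" "w \<in> W"
      using S by (meson Sub_rep)
    have ord: "j \<preceq> u" "u \<preceq> t" "j \<preceq> v" "v \<preceq> t" "u \<preceq> k" "w \<preceq> v"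
      using QU UT QV VT UR WV sub_le_iff[OF S(1,5) mem(2,5)] sub_le_iff[OF S(5,4) mem(5,4)]
        sub_le_iff[OF S(1,6) mem(2,6)] sub_le_iff[OF S(6,4) mem(6,4)] sub_le_iff[OF S(5,3) mem(5,3)]
        sub_le_iff[OF S(7,6) mem(7,6)] by simp_all
    have ih: "i \<in> Hom C (Dom C i) X" and uh: "u \<in> Hom C (Dom C u) X" and kh: "k \<in> Hom C (Dom C k) X"
      and vh: "v \<in> Hom C (Dom C v) X" and wh: "w \<in> Hom C (Dom C w) X"
      using Sub_mem_mono(1) S mem by blast+
    have sub: "i \<odot> h \<preceq> v" if h: "h \<in> Hom C a (Dom C i)" "i \<odot> h \<preceq> u" for a h
    proof -
      have hi: "i \<odot> h \<in> Hom C a X" using comp_hom[OF h(1) ih] .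
      have "i \<odot> h \<preceq> k" using factors_trans[OF h(2) ord(5) hi uh kh] .
      then have "i \<odot> h \<preceq> w"
        using sub_meet_iff[OF X S(2) mem(1) S(3) mem(3) _ hi] mem(7) comp_factors_self[OF ih h(1)]
        unfolding W_def by blast
      then show ?thesis using factors_trans[OF _ ord(6) hi wh vh] by blast
    qed
    have "u \<preceq> v"
    proof (rule sub_diamond[OF X S(2) mem(1) S(1) mem(2) mem(4)[unfolded T_def]], goal_cases)
      case (1 N)
      show ?case by (rule 1(3)[OF S(5) mem(5) S(6) mem(6) ord(1-4) sub])
    qed
    then have "U \<sqsubseteq>\<^bsub>?L\<^esub> V" using sub_le_iff S mem by simp
    then show "(Q \<squnion>\<^bsub>?L\<^esub> P) \<sqinter>\<^bsub>?L\<^esub> R \<sqsubseteq>\<^bsub>?L\<^esub> Q \<squnion>\<^bsub>?L\<^esub> (P \<sqinter>\<^bsub>?L\<^esub> R)"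
      unfolding defs by (simp add: join_comm)
  qed
qed

lemma quotient_transpose:
  assumes X: "X \<in> Obj C" and P: "P \<in> Sub C X" and Q: "Q \<in> Sub C X"
  shows "isomorphic C (quotient_object C P (P \<sqinter>\<^bsub>sub_order C X\<^esub> Q))
    (quotient_object C (P \<squnion>\<^bsub>sub_order C X\<^esub> Q) Q)" (is "isomorphic C ?A ?B")
proof -
  let ?L = "sub_order C X"
  interpret bounded_lattice ?L using sub_order_lattice[OF X] .
  have M: "P \<sqinter>\<^bsub>?L\<^esub> Q \<in> Sub C X" and T: "P \<squnion>\<^bsub>?L\<^esub> Q \<in> Sub C X"
    using meet_closed[of P Q] join_closed[of P Q] P Q by simp_all
  have le: "sub_le C (P \<sqinter>\<^bsub>?L\<^esub> Q) P" "sub_le C Q (P \<squnion>\<^bsub>?L\<^esub> Q)"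
    using meet_left[of P Q] join_right[of P Q] P Q by simp_all
  obtain p i where i: "i \<in> P" "i \<in> Hom C p X" "monic C i" using Sub_rep[OF P] .
  obtain q j where j: "j \<in> Q" "j \<in> Hom C q X" "monic C j" using Sub_rep[OF Q] .
  obtain b m where m: "m \<in> P \<sqinter>\<^bsub>?L\<^esub> Q" "m \<in> Hom C b X" "monic C m" using Sub_rep[OF M] .
  obtain d t where t: "t \<in> P \<squnion>\<^bsub>?L\<^esub> Q" "t \<in> Hom C d X" "monic C t" using Sub_rep[OF T] .
  obtain N where N: "subquotient i j N" "subquotient t j N"
    using sub_diamond[OF X P i(1) Q j(1) t(1)] by metis
  have "subquotient i m ?A" using quotient_object_subquotient[OF M m(1) P i(1) le(1)] .
  then have "subquotient i j ?A"
    using subquotient_cong[OF i(2,3) i(2,3) factors_refl[OF i(2)] factors_refl[OF i(2)]]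
      sub_meet_iff[OF X P i(1) Q j(1) m(1)] by blast
  then have "isomorphic C ?A N" using subquotient_unique[OF i(2)] N(1) by blast
  moreover have "subquotient t j ?B" using quotient_object_subquotient[OF Q j(1) T t(1) le(2)] .
  then have "isomorphic C N ?B" using subquotient_unique[OF t(2)] N(2) by blast
  ultimately show ?thesis by (rule isomorphic_trans)
qed

lemma simple_quotient_iff_covers:
  assumes X: "X \<in> Obj C" and P: "P \<in> Sub C X" and Q: "Q \<in> Sub C X" and le: "sub_le C P Q"
  shows "simple_object C (quotient_object C Q P) \<longleftrightarrow> modular_bounded_lattice.covers (sub_order C X) P Q"
proof -
  interpret modular_bounded_lattice "sub_order C X" using sub_order_modular[OF X] .
  obtain p i where i: "i \<in> P" "i \<in> Hom C p X" "monic C i" using Sub_rep[OF P] .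
  obtain q j where j: "j \<in> Q" "j \<in> Hom C q X" "monic C j" using Sub_rep[OF Q] .
  have ij: "i \<preceq> j" using sub_le_iff[OF P Q i(1) j(1)] le by blast
  have "simple_object C (quotient_object C Q P) \<longleftrightarrow> \<not> j \<preceq> i \<and>
      (\<forall>c. \<forall>l\<in>Hom C c X. monic C l \<and> i \<preceq> l \<and> l \<preceq> j \<longrightarrow> l \<preceq> i \<or> j \<preceq> l)"
    using simple_subquotient_iff[OF j(2,3) i(2,3) ij quotient_object_subquotient[OF P i(1) Q j(1) le]] .
  also have "\<not> j \<preceq> i \<longleftrightarrow> P \<noteq> Q"
    using sub_le_iff[OF Q P j(1) i(1)] Sub_eqI[OF P Q le] factors_refl[OF i(2)]
      sub_le_iff[OF P P i(1) i(1)] by auto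
  also have "(\<forall>c. \<forall>l\<in>Hom C c X. monic C l \<and> i \<preceq> l \<and> l \<preceq> j \<longrightarrow> l \<preceq> i \<or> j \<preceq> l) \<longleftrightarrow>
      (\<forall>R\<in>Sub C X. sub_le C P R \<and> sub_le C R Q \<longrightarrow> R = P \<or> R = Q)" (is "?A \<longleftrightarrow> ?B")
  proof
    assume A: ?A
    show ?B
    proof (intro ballI impI)
      fix R assume R: "R \<in> Sub C X" and PRQ: "sub_le C P R \<and> sub_le C R Q"
      obtain c l where l: "l \<in> R" "l \<in> Hom C c X" "monic C l" using Sub_rep[OF R] .
      have "i \<preceq> l" "l \<preceq> j"
        using PRQ sub_le_iff[OF P R i(1) l(1)] sub_le_iff[OF R Q l(1) j(1)] by blast+
      then have "l \<preceq> i \<or> j \<preceq> l" using A l by blast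
      then have "sub_le C R P \<or> sub_le C Q R"
        using sub_le_iff[OF R P l(1) i(1)] sub_le_iff[OF Q R j(1) l(1)] by blast
      then show "R = P \<or> R = Q" using Sub_eqI[OF R P] Sub_eqI[OF R Q] PRQ by blast
    qed
  next
    assume B: ?B
    show ?A
    proof (intro allI ballI impI)
      fix c l assume l: "l \<in> Hom C c X" and l': "monic C l \<and> i \<preceq> l \<and> l \<preceq> j"
      let ?R = "sub_rel C X `` {l}"
      have R: "?R \<in> Sub C X" "l \<in> ?R" using SubI[OF l] l' by blast+
      have "sub_le C P ?R" "sub_le C ?R Q"
        using l' sub_le_iff[OF P R(1) i(1) R(2)] sub_le_iff[OF R(1) Q R(2) j(1)] by blast+
      then have "?R = P \<or> ?R = Q" using B R(1) by blast
      then have "l \<in> P \<or> l \<in> Q" using R(2) by blast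
      then show "l \<preceq> i \<or> j \<preceq> l" using Sub_mem_iff[OF P i(1)] Sub_mem_iff[OF Q j(1)] by blast
    qed
  qed
  finally show ?thesis unfolding covers_def using le by simp
qed

lemma sub_order_bounds:
  assumes X: "X \<in> Obj C"
  shows "\<bottom>\<^bsub>sub_order C X\<^esub> = zero_sub C X" "\<top>\<^bsub>sub_order C X\<^esub> = full_sub C X"
proof -
  interpret bounded_lattice "sub_order C X" using sub_order_lattice[OF X] .
  show "\<bottom>\<^bsub>sub_order C X\<^esub> = zero_sub C X"
    using bottom_eq[of "zero_sub C X"] zero_sub_in_Sub(1)[OF X] zero_sub_le[OF X] by simp
  show "\<top>\<^bsub>sub_order C X\<^esub> = full_sub C X"
    using top_eq[of "full_sub C X"] full_sub_mem[OF X] sub_le_full[OF X] by simp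
qed

end

section \<open>Composition series and linear extensions\<close>

theorem proposition3p10:
  fixes C :: "('o, 'm) preadd_cat"
    and X :: 'o
    and n :: nat
    and A :: "'m set list"
    and I :: "'i set"
    and S :: "'i \<Rightarrow> 'o"
    and \<psi> \<phi> :: "'i \<Rightarrow> nat"
  assumes "finite_length_category C"
    and "X \<in> Obj C"
    and "composition_series C X n A"
    and "nonisomorphic_factors C n A"
    and "finite I" and "card I = n"
    and "bij_betw \<psi> I {1..n}" and "factors_labelled C I S A \<psi>"
    and "bij_betw \<phi> I {1..n}"
  shows "(\<exists>!B. composition_series C X n B \<and> factors_labelled C I S B \<phi>) \<longleftrightarrow>
         (\<forall>i \<in> I. \<forall>j \<in> I. factor_le C X I S i j \<longrightarrow> \<phi> i \<le> \<phi> j)"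
proof -
  interpret finite_length_category C by fact
  note X = \<open>X \<in> Obj C\<close>
  let ?L = "sub_order C X"
  interpret sub: modular_bounded_lattice ?L using sub_order_modular[OF X] .
  define step where "step i P Q \<longleftrightarrow> sub_le C P Q \<and> P \<noteq> Q \<and> simple_object C (quotient_object C Q P) \<and>
      isomorphic C (S i) (quotient_object C Q P)" for i P Q
  have \<psi>_iso: "isomorphic C (S i) (factor C A (\<psi> i))" if "i \<in> I" for i
    using assms(8) that unfolding factors_labelled_def by blast
  have noniso: "i = j" if ij: "i \<in> I" "j \<in> I" "isomorphic C (S i) Z" "isomorphic C (S j) Z" for i j Z
  proof (rule ccontr)
    assume "i \<noteq> j"
    then have "\<psi> i \<noteq> \<psi> j" using ij assms(7) unfolding bij_betw_def inj_on_def by blast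
    moreover have "isomorphic C (factor C A (\<psi> i)) (factor C A (\<psi> j))"
      using \<psi>_iso ij isomorphic_sym isomorphic_trans by meson
    moreover have "\<psi> i \<in> {1..n}" "\<psi> j \<in> {1..n}" using ij assms(7) bij_betwE by blast+
    ultimately show False
      using assms(4) isomorphic_sym unfolding nonisomorphic_factors_def
      by (metis atLeastAtMost_iff linorder_neqE_nat)
  qed
  interpret fl: factor_lattice ?L I step n
  proof
    fix i P Q assume "P \<in> carrier ?L" "Q \<in> carrier ?L" "step i P Q"
    then show "sub.covers P Q"
      using simple_quotient_iff_covers[OF X, of P Q] unfolding step_def by simp
  next
    fix i P Q assume PQ: "P \<in> carrier ?L" "Q \<in> carrier ?L" and c: "sub.covers (P \<sqinter>\<^bsub>?L\<^esub> Q) P"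
    have c': "sub.covers Q (P \<squnion>\<^bsub>?L\<^esub> Q)" using c sub.covers_transpose[OF PQ] by blast
    have mem: "P \<sqinter>\<^bsub>?L\<^esub> Q \<in> Sub C X" "P \<squnion>\<^bsub>?L\<^esub> Q \<in> Sub C X" "P \<in> Sub C X" "Q \<in> Sub C X"
      using sub.meet_closed[OF PQ] sub.join_closed[OF PQ] PQ by simp_all
    have le: "sub_le C (P \<sqinter>\<^bsub>?L\<^esub> Q) P" "sub_le C Q (P \<squnion>\<^bsub>?L\<^esub> Q)"
      and ne: "P \<sqinter>\<^bsub>?L\<^esub> Q \<noteq> P" "Q \<noteq> P \<squnion>\<^bsub>?L\<^esub> Q"
      using c c' unfolding sub.covers_def by simp_all
    have "isomorphic C (S i) (quotient_object C P (P \<sqinter>\<^bsub>?L\<^esub> Q)) \<longleftrightarrow>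
        isomorphic C (S i) (quotient_object C (P \<squnion>\<^bsub>?L\<^esub> Q) Q)"
      using quotient_transpose[OF X mem(3,4)] isomorphic_sym isomorphic_trans by blast
    then show "step i (P \<sqinter>\<^bsub>?L\<^esub> Q) P \<longleftrightarrow> step i Q (P \<squnion>\<^bsub>?L\<^esub> Q)"
      using le ne c c' simple_quotient_iff_covers[OF X mem(1,3) le(1)]
        simple_quotient_iff_covers[OF X mem(4,2) le(2)] unfolding step_def by blast
  next
    fix i j P Q assume "i \<in> I" "j \<in> I" "step i P Q" "step j P Q"
    then show "i = j" using noniso unfolding step_def by blast
  qed
  have series_iff: "composition_series C X n B \<and> factors_labelled C I S B \<chi> \<longleftrightarrow>
      length B = n + 1 \<and> fl.series ((!) B) \<chi>" if \<chi>: "bij_betw \<chi> I {1..n}" for B \<chi>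
  proof (cases "length B = n + 1")
    case len: True
    have "set B \<subseteq> Sub C X \<longleftrightarrow> (\<forall>k\<le>n. B ! k \<in> Sub C X)"
      using len unfolding subset_code(1) all_set_conv_all_nth by (simp add: less_Suc_eq_le)
    moreover have "(\<forall>k\<in>{1..n}. Q k) \<longleftrightarrow> (\<forall>i\<in>I. Q (\<chi> i))" for Q
      using \<chi> unfolding bij_betw_def by (metis image_eqI image_iff)
    ultimately show ?thesis
      using len \<chi> unfolding composition_series_def factors_labelled_def fl.series_def step_def
        factor_def sub_order_bounds[OF X] by auto
  qed (simp add: composition_series_def)
  interpret fs: factor_series ?L I step n "(!) A" \<psi>
    by unfold_locales (use series_iff[OF assms(7)] assms(3,8) in blast)
  have list_of: "\<exists>B'. composition_series C X n B' \<and> factors_labelled C I S B' \<chi>"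
    if B: "fl.series B \<chi>" for B \<chi>
  proof -
    let ?B = "map B [0..<n + 1]"
    have "fl.series ((!) ?B) \<chi>" using fl.series_cong[of "(!) ?B" B \<chi>] B by (simp del: upt_Suc)
    moreover have "bij_betw \<chi> I {1..n}" using B unfolding fl.series_def by blast
    ultimately have "composition_series C X n ?B \<and> factors_labelled C I S ?B \<chi>"
      using series_iff[of \<chi> ?B] by simp
    then show ?thesis by blast
  qed
  show ?thesis
  proof
    assume "\<exists>!B. composition_series C X n B \<and> factors_labelled C I S B \<phi>"
    then show "\<forall>i\<in>I. \<forall>j\<in>I. factor_le C X I S i j \<longrightarrow> \<phi> i \<le> \<phi> j"
      using assms(9) unfolding factor_le_def by blast
  next
    assume mono: "\<forall>i\<in>I. \<forall>j\<in>I. factor_le C X I S i j \<longrightarrow> \<phi> i \<le> \<phi> j"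
    \<comment> \<open>The partial order may be tested on series of length \<open>n\<close> only, since \<open>n\<close> is the number of labels.\<close>
    have "factor_le C X I S i j" if ij: "\<And>B \<chi>. fl.series B \<chi> \<Longrightarrow> \<chi> i \<le> \<chi> j" for i j
      unfolding factor_le_def
    proof (intro allI impI)
      fix m B \<chi>
      assume B: "composition_series C X m B \<and> bij_betw \<chi> I {1..m} \<and> factors_labelled C I S B \<chi>"
      then have "m = n" using bij_betw_same_card[of \<chi> I "{1..m}"] assms(6) by simp
      then have "fl.series ((!) B) \<chi>" using B series_iff by blast
      then show "\<chi> i \<le> \<chi> j" by (rule ij)
    qed
    then have "\<exists>B. fl.series B \<phi>" using fs.ex_series[OF assms(9)] mono by blast
    then obtain B where B: "composition_series C X n B \<and> factors_labelled C I S B \<phi>"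
      using list_of by blast
    have "B' = B" if B': "composition_series C X n B' \<and> factors_labelled C I S B' \<phi>" for B'
    proof (rule nth_equalityI)
      show "length B' = length B" using B B' unfolding composition_series_def by simp
      fix k assume "k < length B'"
      then have "k \<le> n" using B' unfolding composition_series_def by simp
      then show "B' ! k = B ! k" using fs.series_unique B B' series_iff[OF assms(9)] by blast
    qed
    then show "\<exists>!B. composition_series C X n B \<and> factors_labelled C I S B \<phi>" using B by blast
  qed
qed

end
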